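(* Let $V$ be the Volterra operator on $L^2[0,1]$ and let $S$ be the Donoghue operator on $l^2$ with a positive weight sequence. Then: (a) if a positive operator $T$ on $L^2[0,1]$ semi-commutes with $V$, then $V$ and $T$ are simultaneously ideal-triangularizable; (b) if a positive operator $T$ on $l^2$ semi-commutes with $S$, then $S$ and $T$ are simultaneously ideal-triangularizable.
   Context: The Volterra operator on $L^2[0,1]$ is $(Vf)(x)=\int_0^x f(t)\,dt$. Let $\{e_n\}_{n\ge 0}$ be the standard orthonormal basis of $l^2$, and let $\{w_n\}_{n\ge 1}$ be a monotone decreasing sequence of positive numbers with $\{w_n\}\in l^2$. The (positive) Donoghue operator $S$ with weight sequence $\{w_n\}$ is the bounded operator on $l^2$ determined by $Se_0=0$ and $Se_n=w_ne_{n-1}$ for $n\ge 1$. $L^2[0,1]$ carries the usual almost-everywhere order and $l^2$ the componentwise order; both are Banach lattices. An operator on a Banach lattice $E$ is positive if it maps $E^+$ into itself; $P\ge Q$ means $P-Q$ is positive. Positive operators $A,B$ semi-commute if $AB\ge BA$ or $AB\le BA$. An ideal of $E$ is a linear subspace $J$ such that $0\le|x|\le|y|$ and $y\in J$ imply $x\in J$. A family of operators on $E$ is (simultaneously) ideal-triangularizable if there is a chain of closed ideals of $E$, maximal as a chain in the lattice of all closed ideals of $E$, each member of which is invariant under every operator of the family. *)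

theory Defs
  imports "HOL-Analysis.Analysis" "HOL-Library.Lattice_Algebras"
begin

section \<open>Banach lattices\<close>

class banach_lattice = banach + ordered_real_vector + lattice_ab_group_add_abs +
  assumes lattice_norm_mono: "\<bar>x\<bar> \<le> \<bar>y\<bar> \<Longrightarrow> norm x \<le> norm y"

text \<open>
  Continuity is not demanded of an operator: on a Banach lattice it follows from positivity.
\<close>

definition positive_op :: "('a::banach_lattice \<Rightarrow> 'a) \<Rightarrow> bool" where
  "positive_op A \<longleftrightarrow> linear A \<and> (\<forall>x\<ge>0. 0 \<le> A x)"

definition op_ge :: "('a::banach_lattice \<Rightarrow> 'a) \<Rightarrow> ('a \<Rightarrow> 'a) \<Rightarrow> bool" where
  "op_ge P Q \<longleftrightarrow> positive_op (\<lambda>x. P x - Q x)"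

definition semi_commute :: "('a::banach_lattice \<Rightarrow> 'a) \<Rightarrow> ('a \<Rightarrow> 'a) \<Rightarrow> bool" where
  "semi_commute A B \<longleftrightarrow> op_ge (A \<circ> B) (B \<circ> A) \<or> op_ge (B \<circ> A) (A \<circ> B)"

definition lattice_ideal :: "'a::banach_lattice set \<Rightarrow> bool" where
  "lattice_ideal J \<longleftrightarrow> subspace J \<and> (\<forall>x y. y \<in> J \<and> \<bar>x\<bar> \<le> \<bar>y\<bar> \<longrightarrow> x \<in> J)"

definition ideal_triangularizable :: "('a::banach_lattice \<Rightarrow> 'a) set \<Rightarrow> bool" where
  "ideal_triangularizable F \<longleftrightarrow>
     (\<exists>C. subset.maxchain {J. lattice_ideal J \<and> closed J} C \<and>
          (\<forall>J\<in>C. \<forall>A\<in>F. A ` J \<subseteq> J))"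


section \<open>The Banach lattice of square-summable sequences\<close>

lemma summable_mult_of_squares:
  fixes x y :: "nat \<Rightarrow> real"
  assumes "summable (\<lambda>n. (x n)\<^sup>2)" "summable (\<lambda>n. (y n)\<^sup>2)"
  shows "summable (\<lambda>n. x n * y n)"
proof (rule summable_comparison_test')
  show "summable (\<lambda>n. (x n)\<^sup>2 + (y n)\<^sup>2)"
    using assms by (rule summable_add)
  show "norm (x n * y n) \<le> (x n)\<^sup>2 + (y n)\<^sup>2" if "n \<ge> 0" for n
    using sum_squares_bound[of "\<bar>x n\<bar>" "\<bar>y n\<bar>"] mult_nonneg_nonneg[OF abs_ge_zero[of "x n"] abs_ge_zero[of "y n"]]
    unfolding real_norm_def abs_mult power2_abs by linarith
qed

lemma summable_square_add:
  fixes x y :: "nat \<Rightarrow> real"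
  assumes "summable (\<lambda>n. (x n)\<^sup>2)" "summable (\<lambda>n. (y n)\<^sup>2)"
  shows "summable (\<lambda>n. (x n + y n)\<^sup>2)"
  using summable_add[OF summable_add[OF assms] summable_mult[OF summable_mult_of_squares[OF assms], of 2]]
  by (simp add: power2_sum mult.assoc)

lemma summable_square_dominated:
  fixes x y z :: "nat \<Rightarrow> real"
  assumes "summable (\<lambda>n. (x n)\<^sup>2)" "summable (\<lambda>n. (y n)\<^sup>2)" "\<And>n. z n = x n \<or> z n = y n"
  shows "summable (\<lambda>n. (z n)\<^sup>2)"
proof (rule summable_comparison_test')
  show "summable (\<lambda>n. (x n)\<^sup>2 + (y n)\<^sup>2)"
    using assms(1,2) by (rule summable_add)
  show "norm ((z n)\<^sup>2) \<le> (x n)\<^sup>2 + (y n)\<^sup>2" if "n \<ge> 0" for n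
    using assms(3)[of n] by auto
qed

typedef ell2 = "{x :: nat \<Rightarrow> real. summable (\<lambda>n. (x n)\<^sup>2)}"
  morphisms ell2_nth Abs_ell2
  by (rule exI[of _ "\<lambda>_. 0"]) simp

setup_lifting type_definition_ell2

instantiation ell2 :: real_inner
begin

lift_definition zero_ell2 :: ell2 is "\<lambda>_. 0" by simp

lift_definition plus_ell2 :: "ell2 \<Rightarrow> ell2 \<Rightarrow> ell2" is "\<lambda>x y n. x n + y n"
  by (rule summable_square_add)

lift_definition uminus_ell2 :: "ell2 \<Rightarrow> ell2" is "\<lambda>x n. - x n" by simp

lift_definition minus_ell2 :: "ell2 \<Rightarrow> ell2 \<Rightarrow> ell2" is "\<lambda>x y n. x n - y n"
proof -
  fix x y :: "nat \<Rightarrow> real"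
  assume "summable (\<lambda>n. (x n)\<^sup>2)" "summable (\<lambda>n. (y n)\<^sup>2)"
  then show "summable (\<lambda>n. (x n - y n)\<^sup>2)"
    using summable_square_add[of x "\<lambda>n. - y n"] by simp
qed

lift_definition scaleR_ell2 :: "real \<Rightarrow> ell2 \<Rightarrow> ell2" is "\<lambda>c x n. c * x n"
  by (simp add: power_mult_distrib summable_mult)

lift_definition inner_ell2 :: "ell2 \<Rightarrow> ell2 \<Rightarrow> real" is "\<lambda>x y. \<Sum>n. x n * y n" .

definition norm_ell2 :: "ell2 \<Rightarrow> real" where
  "norm_ell2 x = sqrt (inner x x)"

definition sgn_ell2 :: "ell2 \<Rightarrow> ell2" where
  "sgn_ell2 x = inverse (norm x) *\<^sub>R x"

definition dist_ell2 :: "ell2 \<Rightarrow> ell2 \<Rightarrow> real" where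
  "dist_ell2 x y = norm (x - y)"

definition uniformity_ell2 :: "(ell2 \<times> ell2) filter" where
  "uniformity_ell2 = (INF e\<in>{0<..}. principal {(x, y). dist x y < e})"

definition open_ell2 :: "ell2 set \<Rightarrow> bool" where
  "open_ell2 U \<longleftrightarrow> (\<forall>x\<in>U. \<forall>\<^sub>F (x', y) in uniformity. x' = x \<longrightarrow> y \<in> U)"

instance
proof
  fix x y z :: ell2 and a b r :: real
  show "x + y + z = x + (y + z)" by transfer (simp add: add.assoc)
  show "x + y = y + x" by transfer (simp add: add.commute)
  show "0 + x = x" by transfer simp
  show "- x + x = 0" by transfer simp
  show "x - y = x + - y" by transfer simp
  show "a *\<^sub>R (x + y) = a *\<^sub>R x + a *\<^sub>R y" by transfer (simp add: algebra_simps)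
  show "(a + b) *\<^sub>R x = a *\<^sub>R x + b *\<^sub>R x" by transfer (simp add: algebra_simps)
  show "a *\<^sub>R b *\<^sub>R x = (a * b) *\<^sub>R x" by transfer (simp add: algebra_simps)
  show "1 *\<^sub>R x = x" by transfer simp
  show "sgn x = inverse (norm x) *\<^sub>R x" by (fact sgn_ell2_def)
  show "dist x y = norm (x - y)" by (fact dist_ell2_def)
  show "norm x = sqrt (inner x x)" by (fact norm_ell2_def)
  show "uniformity = (INF e\<in>{0<..}. principal {(x, y::ell2). dist x y < e})"
    by (fact uniformity_ell2_def)
  show "open U \<longleftrightarrow> (\<forall>x\<in>U. \<forall>\<^sub>F (x', y) in uniformity. x' = x \<longrightarrow> y \<in> U)" for U :: "ell2 set"
    by (fact open_ell2_def)
  show "inner x y = inner y x" by transfer (simp add: mult.commute)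
  show "inner (x + y) z = inner x z + inner y z"
    by transfer (simp add: distrib_right suminf_add summable_mult_of_squares)
  show "inner (r *\<^sub>R x) y = r * inner x y"
    by transfer (simp add: mult.assoc suminf_mult summable_mult_of_squares)
  show "0 \<le> inner x x"
    by transfer (simp add: suminf_nonneg summable_mult_of_squares)
  show "inner x x = 0 \<longleftrightarrow> x = 0"
    by transfer (auto simp: suminf_eq_zero_iff summable_mult_of_squares fun_eq_iff)
qed

end

lemma norm_ell2_eq: "norm x = sqrt (\<Sum>n. (ell2_nth x n)\<^sup>2)"
  by (simp add: norm_eq_sqrt_inner inner_ell2.rep_eq power2_eq_square)

lemma summable_ell2_nth: "summable (\<lambda>n. (ell2_nth x n)\<^sup>2)"
  using ell2_nth[of x] by simp

lemma sum_ell2_nth_le: "(\<Sum>n<N. (ell2_nth x n)\<^sup>2) \<le> (norm x)\<^sup>2"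
proof -
  have "(\<Sum>n<N. (ell2_nth x n)\<^sup>2) \<le> (\<Sum>n. (ell2_nth x n)\<^sup>2)"
    by (rule sum_le_suminf[OF summable_ell2_nth]) auto
  moreover have "0 \<le> (\<Sum>n. (ell2_nth x n)\<^sup>2)"
    by (rule suminf_nonneg[OF summable_ell2_nth]) simp
  ultimately show ?thesis by (simp add: norm_ell2_eq)
qed

lemma abs_ell2_nth_le: "\<bar>ell2_nth x n\<bar> \<le> norm x"
proof -
  have "(ell2_nth x n)\<^sup>2 \<le> (\<Sum>k<Suc n. (ell2_nth x k)\<^sup>2)"
    by (simp add: sum_nonneg)
  also have "\<dots> \<le> (norm x)\<^sup>2" by (rule sum_ell2_nth_le)
  finally show ?thesis by (metis abs_le_square_iff abs_norm_cancel)
qed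

instance ell2 :: banach
proof
  fix X :: "nat \<Rightarrow> ell2"
  assume X: "Cauchy X"
  have "Cauchy (\<lambda>k. ell2_nth (X k) n)" for n
  proof (rule metric_CauchyI)
    fix e :: real assume "0 < e"
    then obtain M where M: "\<And>i j. i \<ge> M \<Longrightarrow> j \<ge> M \<Longrightarrow> dist (X i) (X j) < e"
      using X by (meson metric_CauchyD)
    have "dist (ell2_nth (X i) n) (ell2_nth (X j) n) < e" if "i \<ge> M" "j \<ge> M" for i j
      using abs_ell2_nth_le[of "X i - X j" n] M[OF that]
      by (simp add: dist_norm minus_ell2.rep_eq)
    then show "\<exists>M. \<forall>m\<ge>M. \<forall>na\<ge>M. dist (ell2_nth (X m) n) (ell2_nth (X na) n) < e" by blast
  qed
  then have "\<forall>n. \<exists>l. (\<lambda>k. ell2_nth (X k) n) \<longlonglongrightarrow> l"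
    by (simp add: Cauchy_convergent_iff convergent_def)
  then obtain g where g: "\<And>n. (\<lambda>k. ell2_nth (X k) n) \<longlonglongrightarrow> g n" by metis
  have bound: "(\<Sum>n<N. (ell2_nth (X i) n - g n)\<^sup>2) \<le> e\<^sup>2"
    if M: "\<And>j. j \<ge> M \<Longrightarrow> dist (X i) (X j) < e" for e i M N
  proof (rule tendsto_upperbound)
    show "(\<lambda>j. \<Sum>n<N. (ell2_nth (X i) n - ell2_nth (X j) n)\<^sup>2) \<longlonglongrightarrow> (\<Sum>n<N. (ell2_nth (X i) n - g n)\<^sup>2)"
      by (intro tendsto_intros g)
    show "\<forall>\<^sub>F j in sequentially. (\<Sum>n<N. (ell2_nth (X i) n - ell2_nth (X j) n)\<^sup>2) \<le> e\<^sup>2"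
    proof (rule eventually_sequentiallyI)
      fix j assume "M \<le> j"
      have "(\<Sum>n<N. (ell2_nth (X i) n - ell2_nth (X j) n)\<^sup>2) \<le> (norm (X i - X j))\<^sup>2"
        using sum_ell2_nth_le[of "X i - X j" N] by (simp add: minus_ell2.rep_eq)
      also have "\<dots> \<le> e\<^sup>2"
        using M[OF \<open>M \<le> j\<close>] by (intro power_mono) (auto simp: dist_norm)
      finally show "(\<Sum>n<N. (ell2_nth (X i) n - ell2_nth (X j) n)\<^sup>2) \<le> e\<^sup>2" .
    qed
  qed simp
  have diff: "summable (\<lambda>n. (ell2_nth (X i) n - g n)\<^sup>2) \<and> (\<Sum>n. (ell2_nth (X i) n - g n)\<^sup>2) \<le> e\<^sup>2"
    if M: "\<And>j. j \<ge> M \<Longrightarrow> dist (X i) (X j) < e" for e i M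
  proof
    show s: "summable (\<lambda>n. (ell2_nth (X i) n - g n)\<^sup>2)"
      by (rule summableI_nonneg_bounded[where x = "e\<^sup>2"]) (auto intro: bound[OF M])
    show "(\<Sum>n. (ell2_nth (X i) n - g n)\<^sup>2) \<le> e\<^sup>2"
      by (rule suminf_le_const[OF s]) (rule bound[OF M])
  qed
  obtain M where M: "\<And>i j. i \<ge> M \<Longrightarrow> j \<ge> M \<Longrightarrow> dist (X i) (X j) < 1"
    using X zero_less_one by (meson metric_CauchyD)
  have "summable (\<lambda>n. (g n)\<^sup>2)"
    using summable_square_add[OF summable_ell2_nth[of "X M"],
        of "\<lambda>n. - (ell2_nth (X M) n - g n)"] diff[of M M 1] M
    by (simp add: power2_commute)
  then have nth: "ell2_nth (Abs_ell2 g) = g" by (simp add: Abs_ell2_inverse)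
  have "X \<longlonglongrightarrow> Abs_ell2 g"
  proof (rule metric_LIMSEQ_I)
    fix e :: real assume e: "0 < e"
    then obtain M where M: "\<And>i j. i \<ge> M \<Longrightarrow> j \<ge> M \<Longrightarrow> dist (X i) (X j) < e / 2"
      using X by (meson half_gt_zero metric_CauchyD)
    have "dist (X i) (Abs_ell2 g) < e" if "i \<ge> M" for i
    proof -
      have "dist (X i) (Abs_ell2 g) \<le> sqrt ((e / 2)\<^sup>2)"
        using diff[of M i "e / 2"] M[OF that]
        by (simp add: dist_norm norm_ell2_eq minus_ell2.rep_eq nth del: real_sqrt_abs)
      with e show ?thesis by simp
    qed
    then show "\<exists>no. \<forall>n\<ge>no. dist (X n) (Abs_ell2 g) < e" by blast
  qed
  then show "convergent X" by (auto simp: convergent_def)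
qed

instantiation ell2 :: banach_lattice
begin

lift_definition less_eq_ell2 :: "ell2 \<Rightarrow> ell2 \<Rightarrow> bool" is "\<lambda>x y. \<forall>n. x n \<le> y n" .

definition less_ell2 :: "ell2 \<Rightarrow> ell2 \<Rightarrow> bool" where
  "less_ell2 x y \<longleftrightarrow> x \<le> y \<and> \<not> y \<le> x"

lift_definition sup_ell2 :: "ell2 \<Rightarrow> ell2 \<Rightarrow> ell2" is "\<lambda>x y n. max (x n) (y n)"
  by (erule (1) summable_square_dominated) (auto simp: max_def)

lift_definition inf_ell2 :: "ell2 \<Rightarrow> ell2 \<Rightarrow> ell2" is "\<lambda>x y n. min (x n) (y n)"
  by (erule (1) summable_square_dominated) (auto simp: min_def)

lift_definition abs_ell2 :: "ell2 \<Rightarrow> ell2" is "\<lambda>x n. \<bar>x n\<bar>" by simp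

instance
proof
  fix x y z :: ell2 and a b :: real
  show "x < y \<longleftrightarrow> x \<le> y \<and> \<not> y \<le> x" by (fact less_ell2_def)
  show "x \<le> x" by transfer simp
  show "x \<le> y \<Longrightarrow> y \<le> z \<Longrightarrow> x \<le> z" by transfer (meson order_trans)
  show "x \<le> y \<Longrightarrow> y \<le> x \<Longrightarrow> x = y" by transfer (auto intro!: ext antisym)
  show "x \<le> y \<Longrightarrow> z + x \<le> z + y" by transfer simp
  show "inf x y \<le> x" "inf x y \<le> y" by (transfer, simp)+
  show "x \<le> y \<Longrightarrow> x \<le> z \<Longrightarrow> x \<le> inf y z" by transfer simp
  show "x \<le> sup x y" "y \<le> sup x y" by (transfer, simp)+
  show "y \<le> x \<Longrightarrow> z \<le> x \<Longrightarrow> sup y z \<le> x" by transfer simp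
  show "\<bar>x\<bar> = sup x (- x)" by transfer (auto simp: fun_eq_iff abs_real_def max_def)
  show "x \<le> y \<Longrightarrow> 0 \<le> a \<Longrightarrow> a *\<^sub>R x \<le> a *\<^sub>R y" by transfer (simp add: mult_left_mono)
  show "a \<le> b \<Longrightarrow> 0 \<le> x \<Longrightarrow> a *\<^sub>R x \<le> b *\<^sub>R x" by transfer (simp add: mult_right_mono)
  assume le: "\<bar>x\<bar> \<le> \<bar>y\<bar>"
  then have "(ell2_nth x n)\<^sup>2 \<le> (ell2_nth y n)\<^sup>2" for n
    by transfer (simp add: abs_le_square_iff)
  then show "norm x \<le> norm y"
    by (auto simp: norm_ell2_eq intro!: suminf_le summable_ell2_nth)
qed

end

lift_definition ell2_basis :: "nat \<Rightarrow> ell2" is "\<lambda>k n. if n = k then 1 else 0"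
proof -
  fix k
  show "summable (\<lambda>n. (if n = k then 1 else 0 :: real)\<^sup>2)"
    by (rule summable_finite[of "{k}"]) auto
qed

text \<open>
  Only the values of \<open>w\<close> at positive indices matter; \<open>w 0\<close> is junk.
\<close>

definition donoghue_operator :: "(nat \<Rightarrow> real) \<Rightarrow> (ell2 \<Rightarrow> ell2) \<Rightarrow> bool" where
  "donoghue_operator w S \<longleftrightarrow>
     (\<forall>n\<ge>1. 0 < w n) \<and> (\<forall>n\<ge>1. w (Suc n) \<le> w n) \<and> summable (\<lambda>n. (w (Suc n))\<^sup>2) \<and>
     bounded_linear S \<and> S (ell2_basis 0) = 0 \<and>
     (\<forall>n\<ge>1. S (ell2_basis n) = w n *\<^sub>R ell2_basis (n - 1))"


section \<open>The Banach lattice of square-integrable functions on the unit interval\<close>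

definition square_integrable :: "'a measure \<Rightarrow> ('a \<Rightarrow> real) \<Rightarrow> bool" where
  "square_integrable M f \<longleftrightarrow> f \<in> borel_measurable M \<and> integrable M (\<lambda>x. (f x)\<^sup>2)"

lemma square_integrable_bounded:
  fixes f :: "'a \<Rightarrow> real"
  assumes "f \<in> borel_measurable M" "integrable M g" "AE x in M. (f x)\<^sup>2 \<le> g x"
  shows "square_integrable M f"
  unfolding square_integrable_def
  using assms by (auto intro!: Bochner_Integration.integrable_bound[OF assms(2)])

lemma square_integrable_mult:
  assumes "square_integrable M f" "square_integrable M g"
  shows "integrable M (\<lambda>x. f x * g x)"
proof (rule Bochner_Integration.integrable_bound)
  show "integrable M (\<lambda>x. (f x)\<^sup>2 + (g x)\<^sup>2)"
    using assms by (auto simp: square_integrable_def)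
  show "(\<lambda>x. f x * g x) \<in> borel_measurable M"
    using assms by (auto simp: square_integrable_def)
  have "norm (f x * g x) \<le> norm ((f x)\<^sup>2 + (g x)\<^sup>2)" for x
    using sum_squares_bound[of "\<bar>f x\<bar>" "\<bar>g x\<bar>"] mult_nonneg_nonneg[OF abs_ge_zero[of "f x"] abs_ge_zero[of "g x"]]
    unfolding real_norm_def abs_mult power2_abs by linarith
  then show "AE x in M. norm (f x * g x) \<le> norm ((f x)\<^sup>2 + (g x)\<^sup>2)" by simp
qed

lemma square_integrable_add:
  assumes "square_integrable M f" "square_integrable M g"
  shows "square_integrable M (\<lambda>x. f x + g x)"
  using assms square_integrable_mult[OF assms]
  by (auto simp: square_integrable_def power2_sum mult.assoc)

lemma square_integrable_cmult:
  "square_integrable M f \<Longrightarrow> square_integrable M (\<lambda>x. c * f x)"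
  by (auto simp: square_integrable_def power_mult_distrib)

lemma square_integrable_choose:
  assumes "square_integrable M f" "square_integrable M g" "h \<in> borel_measurable M"
    and "\<And>x. h x = f x \<or> h x = g x"
  shows "square_integrable M h"
proof (rule square_integrable_bounded[where g = "\<lambda>x. (f x)\<^sup>2 + (g x)\<^sup>2"])
  have "(h x)\<^sup>2 \<le> (f x)\<^sup>2 + (g x)\<^sup>2" for x using assms(4)[of x] by auto
  then show "AE x in M. (h x)\<^sup>2 \<le> (f x)\<^sup>2 + (g x)\<^sup>2" by simp
qed (use assms in \<open>auto simp: square_integrable_def\<close>)

abbreviation leb01 :: "real measure" where
  "leb01 \<equiv> lebesgue_on {0..1}"

text \<open>
  Representatives are functions on all of the real line; their values off the unit interval
  are invisible to the measure \<open>leb01\<close>, so the quotient identifies functions agreeing almost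
  everywhere on the unit interval.
\<close>

definition L2_rel :: "(real \<Rightarrow> real) \<Rightarrow> (real \<Rightarrow> real) \<Rightarrow> bool" where
  "L2_rel f g \<longleftrightarrow>
     square_integrable leb01 f \<and> square_integrable leb01 g \<and> (AE x in leb01. f x = g x)"

quotient_type L2_01 = "real \<Rightarrow> real" / partial: L2_rel
  morphisms L2_rep L2_class
proof (rule part_equivpI)
  show "\<exists>f. L2_rel f f"
    by (rule exI[of _ "\<lambda>_. 0"]) (simp add: L2_rel_def square_integrable_def)
  show "symp L2_rel" by (auto simp: symp_def L2_rel_def)
  show "transp L2_rel" by (auto simp: transp_def L2_rel_def)
qed

lemma L2_rel_refl: "L2_rel f f \<longleftrightarrow> square_integrable leb01 f"
  by (simp add: L2_rel_def)

instantiation L2_01 :: real_inner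
begin

lift_definition zero_L2_01 :: L2_01 is "\<lambda>_. 0"
  by (simp add: L2_rel_def square_integrable_def)

lift_definition plus_L2_01 :: "L2_01 \<Rightarrow> L2_01 \<Rightarrow> L2_01" is "\<lambda>f g x. f x + g x"
  by (auto simp: L2_rel_def square_integrable_add)

lift_definition uminus_L2_01 :: "L2_01 \<Rightarrow> L2_01" is "\<lambda>f x. - f x"
  by (auto simp: L2_rel_def square_integrable_def)

lift_definition minus_L2_01 :: "L2_01 \<Rightarrow> L2_01 \<Rightarrow> L2_01" is "\<lambda>f g x. f x - g x"
proof -
  have *: "square_integrable leb01 (\<lambda>x. f x - g x)"
    if "square_integrable leb01 f" "square_integrable leb01 g" for f g
    using square_integrable_add[OF that(1) square_integrable_cmult[OF that(2), of "-1"]] by simp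
  show "L2_rel (\<lambda>x. f x - g x) (\<lambda>x. f' x - g' x)" if "L2_rel f f'" "L2_rel g g'" for f f' g g'
    using that by (auto simp: L2_rel_def *)
qed

lift_definition scaleR_L2_01 :: "real \<Rightarrow> L2_01 \<Rightarrow> L2_01" is "\<lambda>c f x. c * f x"
  by (auto simp: L2_rel_def square_integrable_cmult)

lift_definition inner_L2_01 :: "L2_01 \<Rightarrow> L2_01 \<Rightarrow> real"
  is "\<lambda>f g. integral\<^sup>L leb01 (\<lambda>x. f x * g x)"
  by (rule integral_cong_AE) (auto simp: L2_rel_def square_integrable_def)

definition norm_L2_01 :: "L2_01 \<Rightarrow> real" where
  "norm_L2_01 x = sqrt (inner x x)"

definition sgn_L2_01 :: "L2_01 \<Rightarrow> L2_01" where
  "sgn_L2_01 x = inverse (norm x) *\<^sub>R x"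

definition dist_L2_01 :: "L2_01 \<Rightarrow> L2_01 \<Rightarrow> real" where
  "dist_L2_01 x y = norm (x - y)"

definition uniformity_L2_01 :: "(L2_01 \<times> L2_01) filter" where
  "uniformity_L2_01 = (INF e\<in>{0<..}. principal {(x, y). dist x y < e})"

definition open_L2_01 :: "L2_01 set \<Rightarrow> bool" where
  "open_L2_01 U \<longleftrightarrow> (\<forall>x\<in>U. \<forall>\<^sub>F (x', y) in uniformity. x' = x \<longrightarrow> y \<in> U)"

instance
proof
  fix x y z :: L2_01 and a b r :: real
  show "x + y + z = x + (y + z)"
    by transfer (auto simp: L2_rel_def square_integrable_add add.assoc)
  show "x + y = y + x"
    by transfer (auto simp: L2_rel_def square_integrable_add add.commute)
  show "0 + x = x" by transfer (auto simp: L2_rel_def)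
  show "- x + x = 0" by transfer (auto simp: L2_rel_def square_integrable_def)
  show "x - y = x + - y"
  proof transfer
    fix f g assume "L2_rel f f" "L2_rel g g"
    then show "L2_rel (\<lambda>x. f x - g x) (\<lambda>x. f x + - g x)"
      using square_integrable_add[of leb01 f "\<lambda>x. (-1) * g x"] square_integrable_cmult[of leb01 g "-1"]
      by (simp add: L2_rel_refl)
  qed
  show "a *\<^sub>R (x + y) = a *\<^sub>R x + a *\<^sub>R y"
    by transfer (auto simp: L2_rel_def square_integrable_add square_integrable_cmult distrib_left)
  show "(a + b) *\<^sub>R x = a *\<^sub>R x + b *\<^sub>R x"
    by transfer (auto simp: L2_rel_def square_integrable_add square_integrable_cmult distrib_right)
  show "a *\<^sub>R b *\<^sub>R x = (a * b) *\<^sub>R x"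
    by transfer (auto simp: L2_rel_def square_integrable_cmult mult.assoc)
  show "1 *\<^sub>R x = x" by transfer (auto simp: L2_rel_def)
  show "sgn x = inverse (norm x) *\<^sub>R x" by (fact sgn_L2_01_def)
  show "dist x y = norm (x - y)" by (fact dist_L2_01_def)
  show "norm x = sqrt (inner x x)" by (fact norm_L2_01_def)
  show "uniformity = (INF e\<in>{0<..}. principal {(x, y::L2_01). dist x y < e})"
    by (fact uniformity_L2_01_def)
  show "open U \<longleftrightarrow> (\<forall>x\<in>U. \<forall>\<^sub>F (x', y) in uniformity. x' = x \<longrightarrow> y \<in> U)" for U :: "L2_01 set"
    by (fact open_L2_01_def)
  show "inner x y = inner y x" by transfer (simp add: mult.commute)
  show "inner (x + y) z = inner x z + inner y z"
    by transfer (simp add: L2_rel_refl distrib_right square_integrable_mult)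
  show "inner (r *\<^sub>R x) y = r * inner x y"
    by transfer (simp add: mult.assoc)
  show "0 \<le> inner x x" by transfer simp
  show "inner x x = 0 \<longleftrightarrow> x = 0"
  proof transfer
    fix f assume "L2_rel f f"
    then have f: "square_integrable leb01 f" by (simp add: L2_rel_refl)
    have "integral\<^sup>L leb01 (\<lambda>x. f x * f x) = 0 \<longleftrightarrow> (AE x in leb01. f x * f x = 0)"
      by (rule integral_nonneg_eq_0_iff_AE) (auto intro: square_integrable_mult f)
    also have "\<dots> \<longleftrightarrow> L2_rel f (\<lambda>_. 0)"
      using f by (auto simp: L2_rel_def square_integrable_def)
    finally show "integral\<^sup>L leb01 (\<lambda>x. f x * f x) = 0 \<longleftrightarrow> L2_rel f (\<lambda>_. 0)" .
  qed
qed

end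

lemma AE_convergent_of_geometric:
  fixes f :: "nat \<Rightarrow> 'a \<Rightarrow> real"
  assumes "finite_measure M" and f: "\<And>n. f n \<in> borel_measurable M"
    and int: "\<And>n. integrable M (\<lambda>x. (f (Suc n) x - f n x)\<^sup>2)"
    and le: "\<And>n. integral\<^sup>L M (\<lambda>x. (f (Suc n) x - f n x)\<^sup>2) \<le> (1 / 4) ^ n"
  shows "AE x in M. (\<lambda>n. f n x) \<longlonglongrightarrow> lim (\<lambda>n. f n x)"
proof -
  interpret finite_measure M by fact
  define d where "d n x = \<bar>f (Suc n) x - f n x\<bar>" for n x
  define C where "C = 1 + measure M (space M)"
  have d [measurable]: "d n \<in> borel_measurable M" for n
    using f unfolding d_def by measurable
  have bound: "(\<integral>\<^sup>+x. ennreal (d n x) \<partial>M) \<le> ennreal (C * (1 / 2) ^ n)" for n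
  proof -
    let ?h = "\<lambda>x. 2 ^ n * (f (Suc n) x - f n x)\<^sup>2 + (1 / 2) ^ n"
    have "d n x \<le> ?h x" for x
    proof -
      have *: "d n x \<le> c * (d n x)\<^sup>2 + 1 / c" if "c > 0" for c :: real
      proof -
        have "0 \<le> (c * d n x - 1)\<^sup>2" by simp
        moreover have "(c * d n x - 1)\<^sup>2 = c * (c * (d n x)\<^sup>2 + 1 / c) - 2 * (c * d n x)"
          using that by (simp add: power2_eq_square algebra_simps)
        moreover have "0 \<le> c * d n x" using that by (simp add: d_def)
        ultimately have "c * d n x \<le> c * (c * (d n x)\<^sup>2 + 1 / c)" by linarith
        with that show ?thesis by simp
      qed
      show ?thesis using *[of "2 ^ n"] by (simp add: d_def power_one_over)
    qed
    then have "(\<integral>\<^sup>+x. ennreal (d n x) \<partial>M) \<le> (\<integral>\<^sup>+x. ennreal (?h x) \<partial>M)"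
      by (intro nn_integral_mono ennreal_leI)
    also have "\<dots> = ennreal (integral\<^sup>L M ?h)"
      by (rule nn_integral_eq_integral) (auto intro!: Bochner_Integration.integrable_add integrable_mult_right int)
    also have "integral\<^sup>L M ?h = 2 ^ n * integral\<^sup>L M (\<lambda>x. (f (Suc n) x - f n x)\<^sup>2) + measure M (space M) * (1 / 2) ^ n"
      by (subst Bochner_Integration.integral_add) (auto intro!: integrable_mult_right int)
    also have "ennreal \<dots> \<le> ennreal (2 ^ n * (1 / 4) ^ n + measure M (space M) * (1 / 2) ^ n)"
      using le[of n] by (intro ennreal_leI add_right_mono mult_left_mono) auto
    also have "2 ^ n * (1 / 4) ^ n = (1 / 2 :: real) ^ n"
      by (simp flip: power_mult_distrib)
    finally show ?thesis by (simp add: C_def distrib_right)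
  qed
  have "(\<integral>\<^sup>+x. (\<Sum>n. ennreal (d n x)) \<partial>M) = (\<Sum>n. \<integral>\<^sup>+x. ennreal (d n x) \<partial>M)"
    by (rule nn_integral_suminf) simp
  also have "\<dots> \<le> (\<Sum>n. ennreal (C * (1 / 2) ^ n))"
    by (intro suminf_le bound) auto
  also have "\<dots> < \<infinity>"
  proof -
    have "(\<Sum>n. ennreal (C * (1 / 2) ^ n)) \<noteq> top"
      by (rule ennreal_suminf_neq_top) (auto simp: C_def intro!: summable_mult summable_geometric)
    then show ?thesis by (simp add: less_top)
  qed
  finally have "AE x in M. (\<Sum>n. ennreal (d n x)) \<noteq> \<infinity>"
    by (intro nn_integral_PInf_AE) auto
  then show ?thesis
  proof eventually_elim
    case (elim x)
    then have "summable (\<lambda>n. d n x)"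
      by (intro summable_suminf_not_top) (auto simp: d_def)
    then have "summable (\<lambda>n. f (Suc n) x - f n x)"
      unfolding d_def by (rule summable_rabs_cancel)
    then have "convergent (\<lambda>m. \<Sum>n<m. f (Suc n) x - f n x)"
      by (simp add: summable_iff_convergent)
    then have "convergent (\<lambda>m. f m x - f 0 x)"
      by (simp add: sum_lessThan_telescope[of "\<lambda>n. f n x"])
    then have "convergent (\<lambda>m. f m x - f 0 x + f 0 x)"
      by (intro convergent_add convergent_const)
    then have "convergent (\<lambda>n. f n x)" by simp
    then show ?case by (simp add: convergent_LIMSEQ_iff)
  qed
qed

lemma square_integrable_limit:
  fixes f :: "nat \<Rightarrow> 'a \<Rightarrow> real"
  assumes f: "\<And>n. square_integrable M (f n)" and g [measurable]: "g \<in> borel_measurable M"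
    and lim: "AE x in M. (\<lambda>n. f n x) \<longlonglongrightarrow> g x"
    and e: "0 \<le> e" "\<And>j. j \<ge> N \<Longrightarrow> integral\<^sup>L M (\<lambda>x. (h x - f j x)\<^sup>2) \<le> e"
    and h: "square_integrable M h"
  shows "square_integrable M (\<lambda>x. h x - g x)" "integral\<^sup>L M (\<lambda>x. (h x - g x)\<^sup>2) \<le> e"
proof -
  have [measurable]: "f n \<in> borel_measurable M" "h \<in> borel_measurable M" for n
    using f h by (auto simp: square_integrable_def)
  have diff: "integrable M (\<lambda>x. (h x - f j x)\<^sup>2)" for j
    using square_integrable_add[OF h square_integrable_cmult[OF f[of j], of "-1"]]
    by (simp add: square_integrable_def)
  have "(\<integral>\<^sup>+x. ennreal ((h x - g x)\<^sup>2) \<partial>M) = (\<integral>\<^sup>+x. liminf (\<lambda>j. ennreal ((h x - f j x)\<^sup>2)) \<partial>M)"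
  proof (rule nn_integral_cong_AE)
    show "AE x in M. ennreal ((h x - g x)\<^sup>2) = liminf (\<lambda>j. ennreal ((h x - f j x)\<^sup>2))"
      using lim
    proof eventually_elim
      case (elim x)
      then have "(\<lambda>j. ennreal ((h x - f j x)\<^sup>2)) \<longlonglongrightarrow> ennreal ((h x - g x)\<^sup>2)"
        by (intro tendsto_intros)
      then show ?case by (intro lim_imp_Liminf[symmetric]) simp_all
    qed
  qed
  also have "\<dots> \<le> liminf (\<lambda>j. \<integral>\<^sup>+x. ennreal ((h x - f j x)\<^sup>2) \<partial>M)"
    by (rule nn_integral_liminf) simp
  also have "\<dots> \<le> liminf (\<lambda>j. ennreal e)"
  proof (rule Liminf_mono, rule eventually_sequentiallyI)
    fix j assume "N \<le> j"
    then show "(\<integral>\<^sup>+x. ennreal ((h x - f j x)\<^sup>2) \<partial>M) \<le> ennreal e"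
      by (subst nn_integral_eq_integral[OF diff]) (auto intro: ennreal_leI e)
  qed
  finally have le: "(\<integral>\<^sup>+x. ennreal ((h x - g x)\<^sup>2) \<partial>M) \<le> ennreal e"
    by (simp add: Liminf_const)
  then have int: "integrable M (\<lambda>x. (h x - g x)\<^sup>2)"
    by (intro integrableI_bounded) (auto intro: le_less_trans)
  then show "square_integrable M (\<lambda>x. h x - g x)"
    by (simp add: square_integrable_def)
  show "integral\<^sup>L M (\<lambda>x. (h x - g x)\<^sup>2) \<le> e"
    using le e(1) by (simp add: nn_integral_eq_integral[OF int])
qed

lemma square_integrable_L2_rep: "square_integrable leb01 (L2_rep u)"
  using Quotient3_rep_reflp[OF Quotient3_L2_01] by (simp add: L2_rel_refl)

lemma L2_class_rep: "L2_class (L2_rep u) = u"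
  by (rule Quotient3_abs_rep[OF Quotient3_L2_01])

lemma norm_diff_L2_class:
  assumes "square_integrable leb01 f" "square_integrable leb01 g"
  shows "norm (L2_class f - L2_class g) = sqrt (integral\<^sup>L leb01 (\<lambda>x. (f x - g x)\<^sup>2))"
proof -
  have "square_integrable leb01 (\<lambda>x. f x - g x)"
    using square_integrable_add[OF assms(1) square_integrable_cmult[OF assms(2), of "-1"]] by simp
  with assms show ?thesis
    by (simp add: norm_eq_sqrt_inner minus_L2_01.abs_eq inner_L2_01.abs_eq L2_rel_refl power2_eq_square)
qed

lemma finite_measure_leb01: "finite_measure leb01"
  by (rule finite_measure_lebesgue_on) auto

instance L2_01 :: banach
proof
  fix X :: "nat \<Rightarrow> L2_01"
  assume X: "Cauchy X"
  have "\<exists>N. \<forall>i\<ge>N. \<forall>j\<ge>N. dist (X i) (X j) < (1 / 2) ^ n" for n :: nat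
    using X by (simp add: Cauchy_def)
  then obtain N where N: "\<And>n i j. i \<ge> N n \<Longrightarrow> j \<ge> N n \<Longrightarrow> dist (X i) (X j) < (1 / 2) ^ n"
    by metis
  define r where "r n = n + (\<Sum>k\<le>n. N k)" for n
  have "N n \<le> (\<Sum>k\<le>n. N k)" for n by (rule member_le_sum) auto
  then have r: "N n \<le> r n" "r n < r (Suc n)" for n
    unfolding r_def by (auto intro: le_trans trans_le_add2)
  have sm: "strict_mono r" by (simp add: strict_mono_Suc_iff r)
  define f where "f n = L2_rep (X (r n))" for n
  have f: "square_integrable leb01 (f n)" for n
    unfolding f_def by (rule square_integrable_L2_rep)
  have f': "f n \<in> borel_measurable leb01" for n
    using f[of n] by (simp add: square_integrable_def)
  have dist: "dist (X (r i)) (X (r j)) = sqrt (integral\<^sup>L leb01 (\<lambda>x. (f i x - f j x)\<^sup>2))" for i j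
    using norm_diff_L2_class[OF f f, of i j] by (simp add: dist_norm f_def L2_class_rep)
  have int_le: "integral\<^sup>L leb01 (\<lambda>x. (f i x - f j x)\<^sup>2) \<le> ((1 / 2) ^ n)\<^sup>2" if "i \<ge> n" "j \<ge> n" for i j n
  proof -
    have "N n \<le> r i" "N n \<le> r j"
      using that r(1)[of n] sm by (meson le_trans strict_mono_less_eq)+
    then have "sqrt (integral\<^sup>L leb01 (\<lambda>x. (f i x - f j x)\<^sup>2)) \<le> (1 / 2) ^ n"
      using N[of n "r i" "r j"] by (simp add: dist)
    then show ?thesis by (rule sqrt_le_D)
  qed
  define g where "g x = lim (\<lambda>n. f n x)" for x
  have g: "g \<in> borel_measurable leb01"
    unfolding g_def by (intro borel_measurable_lim_metric f')
  have lim: "AE x in leb01. (\<lambda>n. f n x) \<longlonglongrightarrow> g x"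
    unfolding g_def
  proof (rule AE_convergent_of_geometric)
    fix n
    show "integrable leb01 (\<lambda>x. (f (Suc n) x - f n x)\<^sup>2)"
      using square_integrable_add[OF f[of "Suc n"] square_integrable_cmult[OF f[of n], of "-1"]]
      by (simp add: square_integrable_def)
    show "integral\<^sup>L leb01 (\<lambda>x. (f (Suc n) x - f n x)\<^sup>2) \<le> (1 / 4) ^ n"
      using int_le[of n "Suc n" n] by (simp add: power2_eq_square flip: power_mult_distrib)
  qed (use f' finite_measure_leb01 in auto)
  have lims: "square_integrable leb01 (\<lambda>x. f n x - g x)"
    "integral\<^sup>L leb01 (\<lambda>x. (f n x - g x)\<^sup>2) \<le> ((1 / 2) ^ n)\<^sup>2" for n
    using square_integrable_limit[where N = n and h = "f n" and e = "((1 / 2) ^ n)\<^sup>2", OF f g lim] f int_le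
    by auto
  have gs: "square_integrable leb01 g"
    using square_integrable_add[OF f[of 0] square_integrable_cmult[OF lims(1)[of 0], of "-1"]] by simp
  have "dist (X (r n)) (L2_class g) \<le> (1 / 2) ^ n" for n
  proof -
    have "dist (X (r n)) (L2_class g) = sqrt (integral\<^sup>L leb01 (\<lambda>x. (f n x - g x)\<^sup>2))"
      using norm_diff_L2_class[OF f gs, of n] by (simp add: dist_norm f_def L2_class_rep)
    also have "\<dots> \<le> sqrt (((1 / 2) ^ n)\<^sup>2)" by (rule real_sqrt_le_mono) (rule lims)
    finally show ?thesis by simp
  qed
  then have "\<forall>n. norm (dist (X (r n)) (L2_class g)) \<le> (1 / 2) ^ n" by simp
  then have "(\<lambda>n. dist (X (r n)) (L2_class g)) \<longlonglongrightarrow> 0"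
    by (rule Lim_null_comparison[OF always_eventually LIMSEQ_power_zero]) simp
  then have "(X \<circ> r) \<longlonglongrightarrow> L2_class g"
    unfolding o_def by (rule tendsto_dist_iff[THEN iffD2])
  then show "convergent X"
    using Cauchy_converges_subseq[OF X sm] by (auto simp: convergent_def)
qed

instantiation L2_01 :: banach_lattice
begin

lift_definition less_eq_L2_01 :: "L2_01 \<Rightarrow> L2_01 \<Rightarrow> bool" is "\<lambda>f g. AE x in leb01. f x \<le> g x"
proof -
  show "(AE x in leb01. f x \<le> g x) = (AE x in leb01. f' x \<le> g' x)"
    if "L2_rel f f'" "L2_rel g g'" for f f' g g'
  proof -
    have "AE x in leb01. f x = f' x" "AE x in leb01. g x = g' x"
      using that by (simp_all add: L2_rel_def)
    then have "AE x in leb01. f x \<le> g x \<longleftrightarrow> f' x \<le> g' x"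
      by eventually_elim simp
    then show ?thesis by (rule eventually_subst)
  qed
qed

definition less_L2_01 :: "L2_01 \<Rightarrow> L2_01 \<Rightarrow> bool" where
  "less_L2_01 u v \<longleftrightarrow> u \<le> v \<and> \<not> v \<le> u"

lift_definition sup_L2_01 :: "L2_01 \<Rightarrow> L2_01 \<Rightarrow> L2_01" is "\<lambda>f g x. max (f x) (g x)"
proof -
  have *: "square_integrable leb01 (\<lambda>x. max (f x) (g x))"
    if "square_integrable leb01 f" "square_integrable leb01 g" for f g
    by (rule square_integrable_choose[OF that]) (use that in \<open>auto simp: square_integrable_def max_def\<close>)
  show "L2_rel (\<lambda>x. max (f x) (g x)) (\<lambda>x. max (f' x) (g' x))"
    if "L2_rel f f'" "L2_rel g g'" for f f' g g'
    using that by (auto simp: L2_rel_def *)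
qed

lift_definition inf_L2_01 :: "L2_01 \<Rightarrow> L2_01 \<Rightarrow> L2_01" is "\<lambda>f g x. min (f x) (g x)"
proof -
  have *: "square_integrable leb01 (\<lambda>x. min (f x) (g x))"
    if "square_integrable leb01 f" "square_integrable leb01 g" for f g
    by (rule square_integrable_choose[OF that]) (use that in \<open>auto simp: square_integrable_def min_def\<close>)
  show "L2_rel (\<lambda>x. min (f x) (g x)) (\<lambda>x. min (f' x) (g' x))"
    if "L2_rel f f'" "L2_rel g g'" for f f' g g'
    using that by (auto simp: L2_rel_def *)
qed

lift_definition abs_L2_01 :: "L2_01 \<Rightarrow> L2_01" is "\<lambda>f x. \<bar>f x\<bar>"
  by (auto simp: L2_rel_def square_integrable_def)

instance
proof
  fix u v w :: L2_01 and a b :: real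
  show "u < v \<longleftrightarrow> u \<le> v \<and> \<not> v \<le> u" by (fact less_L2_01_def)
  show "u \<le> u" by transfer simp
  show "u \<le> v \<Longrightarrow> v \<le> w \<Longrightarrow> u \<le> w" by transfer auto
  show "u \<le> v \<Longrightarrow> v \<le> u \<Longrightarrow> u = v" by transfer (auto simp: L2_rel_def)
  show "u \<le> v \<Longrightarrow> w + u \<le> w + v" by transfer auto
  show "inf u v \<le> u" "inf u v \<le> v" by (transfer, simp)+
  show "u \<le> v \<Longrightarrow> u \<le> w \<Longrightarrow> u \<le> inf v w" by transfer auto
  show "u \<le> sup u v" "v \<le> sup u v" by (transfer, simp)+
  show "v \<le> u \<Longrightarrow> w \<le> u \<Longrightarrow> sup v w \<le> u" by transfer auto
  show "\<bar>u\<bar> = sup u (- u)"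
  proof transfer
    fix f assume "L2_rel f f"
    moreover have "(\<lambda>x. max (f x) (- f x)) = (\<lambda>x. \<bar>f x\<bar>)" by (auto simp: fun_eq_iff)
    ultimately show "L2_rel (\<lambda>x. \<bar>f x\<bar>) (\<lambda>x. max (f x) (- f x))"
      by (auto simp: L2_rel_def square_integrable_def)
  qed
  show "u \<le> v \<Longrightarrow> 0 \<le> a \<Longrightarrow> a *\<^sub>R u \<le> a *\<^sub>R v" by transfer (auto intro: mult_left_mono)
  show "a \<le> b \<Longrightarrow> 0 \<le> u \<Longrightarrow> a *\<^sub>R u \<le> b *\<^sub>R u" by transfer (auto intro: mult_right_mono)
  have "\<bar>u\<bar> \<le> \<bar>v\<bar> \<Longrightarrow> inner u u \<le> inner v v"
  proof transfer
    fix f g :: "real \<Rightarrow> real"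
    assume f: "L2_rel f f" and g: "L2_rel g g" and le: "AE x in leb01. \<bar>f x\<bar> \<le> \<bar>g x\<bar>"
    show "integral\<^sup>L leb01 (\<lambda>x. f x * f x) \<le> integral\<^sup>L leb01 (\<lambda>x. g x * g x)"
    proof (rule integral_mono_AE)
      show "AE x in leb01. f x * f x \<le> g x * g x"
        using le by eventually_elim (simp add: abs_le_square_iff flip: power2_eq_square)
    qed (use f g in \<open>auto simp: L2_rel_refl intro: square_integrable_mult\<close>)
  qed
  then show "\<bar>u\<bar> \<le> \<bar>v\<bar> \<Longrightarrow> norm u \<le> norm v"
    by (simp add: norm_eq_sqrt_inner)
qed

end

lemma integrable_of_square_integrable_leb01:
  assumes "square_integrable leb01 f"
  shows "integrable leb01 f"
  using square_integrable_mult[OF assms, of "\<lambda>_. 1"] finite_measure_leb01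
  by (simp add: square_integrable_def finite_measure.integrable_const)

lift_definition volterra :: "L2_01 \<Rightarrow> L2_01" is "\<lambda>f x. integral\<^sup>L (lebesgue_on {0..x}) f"
proof -
  have sub: "lebesgue_on {0..x} = restrict_space leb01 {0..x}" if "x \<in> {0..1}" for x :: real
    using that by (subst restrict_restrict_space) (auto simp: Int_absorb1)
  have int: "integrable (lebesgue_on {0..x}) f" if "x \<in> {0..1}" "integrable leb01 f"
    for x :: real and f :: "real \<Rightarrow> real"
    by (rule integrable_subinterval[OF that(2)]) (use that in auto)
  have sq: "square_integrable leb01 (\<lambda>x. integral\<^sup>L (lebesgue_on {0..x}) f)"
    if "square_integrable leb01 f" for f
  proof -
    let ?F = "\<lambda>x. integral\<^sup>L (lebesgue_on {0..x}) f"
    have f: "integrable leb01 f" by (rule integrable_of_square_integrable_leb01[OF that])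
    then have "continuous_on {0..1} (\<lambda>x. Henstock_Kurzweil_Integration.integral {0..x} f)"
      by (intro indefinite_integral_continuous_1 integrable_on_lebesgue_on) auto
    moreover have "?F x = Henstock_Kurzweil_Integration.integral {0..x} f" if "x \<in> {0..1}" for x
      by (rule lebesgue_integral_eq_integral[OF int[OF that f]]) simp
    ultimately have cont: "continuous_on {0..1} ?F"
      by (subst continuous_on_cong[OF refl]) auto
    have F: "?F \<in> borel_measurable leb01"
      by (rule continuous_imp_measurable_on_sets_lebesgue[OF cont]) simp
    obtain B where B: "\<And>x. x \<in> {0..1} \<Longrightarrow> norm (?F x) \<le> B"
      using compact_imp_bounded[OF compact_continuous_image[OF cont]] unfolding bounded_iff by blast
    show ?thesis
    proof (rule square_integrable_bounded[OF F])
      show "integrable leb01 (\<lambda>_. B\<^sup>2)"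
        using finite_measure_leb01 by (simp add: finite_measure.integrable_const)
      have "(?F x)\<^sup>2 \<le> B\<^sup>2" if "x \<in> {0..1}" for x
        using power_mono[OF B[OF that], of 2] by simp
      then show "AE x in leb01. (?F x)\<^sup>2 \<le> B\<^sup>2" by (intro AE_I2) simp
    qed
  qed
  show "L2_rel (\<lambda>x. integral\<^sup>L (lebesgue_on {0..x}) f) (\<lambda>x. integral\<^sup>L (lebesgue_on {0..x}) g)"
    if "L2_rel f g" for f g
  proof -
    have f: "square_integrable leb01 f" and g: "square_integrable leb01 g"
      and eq: "AE x in leb01. f x = g x"
      using that by (auto simp: L2_rel_def)
    have "integral\<^sup>L (lebesgue_on {0..x}) f = integral\<^sup>L (lebesgue_on {0..x}) g" if x: "x \<in> {0..1}" for x
    proof (rule integral_cong_AE)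
      show "f \<in> borel_measurable (lebesgue_on {0..x})" "g \<in> borel_measurable (lebesgue_on {0..x})"
        using int[OF x integrable_of_square_integrable_leb01] f g by auto
      have "{0..x} \<in> sets leb01" using x by (auto simp: sets_restrict_space_iff)
      then show "AE t in lebesgue_on {0..x}. f t = g t"
        using eq x by (subst sub[OF x], subst AE_restrict_space_iff) (auto simp: min_def)
    qed
    then show ?thesis
      using sq[OF f] sq[OF g] by (auto simp: L2_rel_def intro!: AE_I2)
  qed
qed

end

theory Submission
  imports Defs
begin

text \<open>
  In both spaces there is one natural chain: the ideals of the functions that vanish on \<open>[0,a]\<close>,
  for \<open>a\<close> in \<open>[0,1]\<close>, and the ideals spanned by the first \<open>n\<close> basis vectors together with the
  whole of \<open>l\<^sup>2\<close>. These chains are maximal (\<open>maxchain_vanishing_ideals\<close>, \<open>maxchain_initial_ideals\<close>),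
  so what has to be shown is that every positive operator \<open>T\<close> that semi-commutes with the given
  operator leaves their members invariant. The given operator is itself such a \<open>T\<close>, because it
  commutes with itself.

  Positive operators are continuous. Hence an ideal is invariant once the images of a few positive
  generators are known to lie in it (\<open>closed_ideal_pullback\<close>). On \<open>L\<^sup>2\<close> a single indicator
  function generates each ideal of the chain; on \<open>l\<^sup>2\<close> finitely many basis vectors generate each
  proper one.

  For the generators, the semi-commutation inequality is iterated to one between \<open>B\<^sup>n T\<close> and
  \<open>T B\<^sup>n\<close>, where \<open>B\<close> is the Volterra or the Donoghue operator. The powers of \<open>B\<close> are explicit:
  those of the Volterra operator take indicators to truncated powers, and those of the Donoghue
  operator are weighted shifts. A mass that \<open>T\<close> moves to the wrong side of the chain shows up in
  the smaller side of this inequality and keeps it from decaying, with growing \<open>n\<close>, as fast as the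
  larger side does. Letting \<open>n\<close> tend to infinity shows that there is no such mass
  (\<open>inner_op_ramp_init_indicator_nonpos\<close>, \<open>op_basis_in_initial_ideal\<close>). For the Donoghue operator
  and one of the two directions of the inequality, \<open>B\<^sup>n\<close> even annihilates the generator for large
  \<open>n\<close>.
\<close>

section \<open>Positive operators and closed ideals of Banach lattices\<close>

lemma norm_lattice_abs [simp]: "norm \<bar>x\<bar> = norm (x::'a::banach_lattice)"
  by (rule antisym; rule lattice_norm_mono) simp_all

lemma norm_mono_nonneg:
  fixes x y :: "'a::banach_lattice"
  assumes "0 \<le> x" "x \<le> y"
  shows "norm x \<le> norm y"
  by (rule lattice_norm_mono) (use assms in \<open>simp add: order_trans[OF assms]\<close>)

lemma continuous_lattice_abs: "continuous_on A (abs :: 'a::banach_lattice \<Rightarrow> 'a)"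
proof (rule continuous_onI)
  fix x :: 'a and e :: real assume "0 < e"
  have "dist \<bar>y\<bar> \<bar>x\<bar> \<le> dist y x" for y
    unfolding dist_norm by (rule lattice_norm_mono) (rule abs_triangle_ineq3)
  then show "\<exists>d>0. \<forall>x'\<in>A. dist x' x < d \<longrightarrow> dist \<bar>x'\<bar> \<bar>x\<bar> \<le> e"
    using \<open>0 < e\<close> by (meson less_imp_le order_trans)
qed

lemma closed_nonneg_cone: "closed {x::'a::banach_lattice. 0 \<le> x}"
proof -
  have "{x::'a. 0 \<le> x} = {x. \<bar>x\<bar> = x}"
    by (metis abs_ge_zero abs_of_nonneg)
  then show ?thesis
    by (auto intro!: closed_Collect_eq continuous_lattice_abs continuous_on_id)
qed

lemma abs_scaleR_le: "\<bar>c *\<^sub>R x\<bar> \<le> \<bar>c\<bar> *\<^sub>R \<bar>x::'a::banach_lattice\<bar>"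
proof -
  have *: "d *\<^sub>R x \<le> \<bar>d\<bar> *\<^sub>R \<bar>x\<bar>" for d
  proof (cases "0 \<le> d")
    case True
    then show ?thesis by (simp add: scaleR_left_mono abs_ge_self)
  next
    case False
    then have "(- d) *\<^sub>R (- x) \<le> (- d) *\<^sub>R \<bar>x\<bar>"
      by (intro scaleR_left_mono) (auto simp: abs_ge_minus_self)
    with False show ?thesis by simp
  qed
  show ?thesis using *[of c] *[of "- c"] by (intro abs_leI) auto
qed

lemma positive_op_mono:
  assumes "positive_op A" "x \<le> y"
  shows "A x \<le> A y"
proof -
  have "0 \<le> A (y - x)" using assms by (simp add: positive_op_def)
  also have "A (y - x) = A y - A x" using assms by (simp add: positive_op_def linear_diff)
  finally show ?thesis by simp
qed

lemma positive_op_abs_le: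
  assumes "positive_op A"
  shows "\<bar>A x\<bar> \<le> A \<bar>x\<bar>"
proof (rule abs_leI)
  show "A x \<le> A \<bar>x\<bar>" by (rule positive_op_mono[OF assms]) (rule abs_ge_self)
  have "- A x = A (- x)" using assms by (simp add: positive_op_def linear_neg)
  also have "\<dots> \<le> A \<bar>x\<bar>" by (rule positive_op_mono[OF assms]) (rule abs_ge_minus_self)
  finally show "- A x \<le> A \<bar>x\<bar>" .
qed

text \<open>
  If \<open>A\<close> were unbounded on the positive cone, there would be positive \<open>y n\<close> of norm \<open>2\<^sup>-\<^sup>n\<close>
  with \<open>norm (A (y n)) \<ge> n\<close>. Their sum \<open>y\<close> dominates each \<open>y n\<close> because the cone is closed,
  so positivity forces \<open>norm (A y) \<ge> n\<close> for every \<open>n\<close>.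
\<close>

lemma positive_op_bounded_linear:
  fixes A :: "'a::banach_lattice \<Rightarrow> 'a"
  assumes A: "positive_op A"
  shows "bounded_linear A"
proof -
  have lin: "linear A" using A by (simp add: positive_op_def)
  have "\<exists>K. \<forall>x. 0 \<le> x \<longrightarrow> norm (A x) \<le> norm x * K"
  proof (rule ccontr)
    assume "\<not> ?thesis"
    then have "\<forall>n::nat. \<exists>x. 0 \<le> x \<and> \<not> norm (A x) \<le> norm x * (real n * 2 ^ n)" by blast
    then obtain x where x: "\<And>n. 0 \<le> x n" "\<And>n::nat. norm (x n) * (real n * 2 ^ n) < norm (A (x n))"
      by (metis not_le)
    have nz: "norm (x n) > 0" for n
      using x(2)[of n] lin by (auto simp: linear_0)
    define y where "y n = ((1 / 2) ^ n / norm (x n)) *\<^sub>R x n" for n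
    have y0: "0 \<le> y n" for n
      using x(1) by (simp add: y_def scaleR_nonneg_nonneg)
    have ny: "norm (y n) = (1 / 2) ^ n" for n
      using nz[of n] by (simp add: y_def)
    have large: "real n \<le> norm (A (y n))" for n
    proof -
      have "norm (A (y n)) = (1 / 2) ^ n / norm (x n) * norm (A (x n))"
        using nz[of n] by (simp add: y_def linear_scale[OF lin])
      also have "\<dots> \<ge> (1 / 2) ^ n / norm (x n) * (norm (x n) * (real n * 2 ^ n))"
        using x(2)[of n] nz[of n] by (intro mult_left_mono) auto
      also have "(1 / 2) ^ n / norm (x n) * (norm (x n) * (real n * 2 ^ n)) = real n"
        using nz[of n] by (simp add: power_one_over)
      finally show ?thesis .
    qed
    have sy: "summable y"
      by (rule summable_norm_cancel) (simp add: ny summable_geometric)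
    have le: "y n \<le> suminf y" for n
    proof -
      have "(\<lambda>N. sum y {..<N} - y n) \<longlonglongrightarrow> suminf y - y n"
        by (intro tendsto_diff summable_LIMSEQ sy tendsto_const)
      moreover have "\<forall>\<^sub>F N in sequentially. sum y {..<N} - y n \<in> {x. 0 \<le> x}"
      proof (rule eventually_sequentiallyI)
        fix N assume "Suc n \<le> N"
        then have "sum y {..<N} = y n + sum y ({..<N} - {n})" by (intro sum.remove) auto
        then show "sum y {..<N} - y n \<in> {x. 0 \<le> x}" by (simp add: sum_nonneg y0)
      qed
      ultimately have "suminf y - y n \<in> {x. 0 \<le> x}"
        using closed_nonneg_cone by (intro Lim_in_closed_set) auto
      then show ?thesis by simp
    qed
    obtain n :: nat where "norm (A (suminf y)) < real n" using reals_Archimedean2 by blast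
    also have "real n \<le> norm (A (y n))" by (rule large)
    also have "\<dots> \<le> norm (A (suminf y))"
      using A y0[of n] positive_op_mono[OF A le[of n]]
      by (intro norm_mono_nonneg) (auto simp: positive_op_def)
    finally show False by simp
  qed
  then obtain K where K: "\<And>x. 0 \<le> x \<Longrightarrow> norm (A x) \<le> norm x * K" by blast
  have "norm (A x) \<le> norm x * K" for x
  proof -
    have "norm (A x) \<le> norm (A \<bar>x\<bar>)"
      by (rule lattice_norm_mono) (rule order_trans[OF positive_op_abs_le[OF A] abs_ge_self])
    also have "\<dots> \<le> norm x * K" using K[of "\<bar>x\<bar>"] by simp
    finally show ?thesis .
  qed
  with lin show ?thesis by (auto intro!: bounded_linear_intro simp: linear_add linear_scale)
qed

text \<open>
  Closed ideals arise from closed conditions on the modulus. The two conditions of interest are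
  that a positive functional annihilates \<open>\<bar>u\<bar>\<close> and that a positive operator sends \<open>\<bar>u\<bar>\<close> into a
  given closed ideal.
\<close>

lemma closed_ideal_of_hereditary_set:
  fixes K :: "'a::banach_lattice set"
  assumes "closed K" "0 \<in> K"
    and add: "\<And>x y. x \<in> K \<Longrightarrow> y \<in> K \<Longrightarrow> x + y \<in> K"
    and scale: "\<And>c x. x \<in> K \<Longrightarrow> c *\<^sub>R x \<in> K"
    and hereditary: "\<And>x y. 0 \<le> x \<Longrightarrow> x \<le> y \<Longrightarrow> y \<in> K \<Longrightarrow> x \<in> K"
  shows "lattice_ideal {u. \<bar>u\<bar> \<in> K}" "closed {u. \<bar>u\<bar> \<in> K}"
proof -
  show "lattice_ideal {u. \<bar>u\<bar> \<in> K}"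
    unfolding lattice_ideal_def subspace_def
    using assms(2) hereditary[OF abs_ge_zero abs_triangle_ineq add]
      hereditary[OF abs_ge_zero abs_scaleR_le scale] hereditary[OF abs_ge_zero]
    by simp blast
  show "closed {u. \<bar>u\<bar> \<in> K}"
    using continuous_on_closed_vimage[OF closed_UNIV, of abs] continuous_lattice_abs[of UNIV] assms(1)
    by (auto simp: vimage_def)
qed

lemma lattice_ideal_hereditary:
  assumes "lattice_ideal J" "0 \<le> x" "x \<le> y" "y \<in> J"
  shows "x \<in> J"
proof -
  have "\<bar>x\<bar> \<le> \<bar>y\<bar>" using order_trans[OF assms(2,3)] assms(2,3) by simp
  with assms(1,4) show ?thesis unfolding lattice_ideal_def by blast
qed

lemma lattice_ideal_abs:
  assumes "lattice_ideal J"
  shows "\<bar>x\<bar> \<in> J \<longleftrightarrow> x \<in> J"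
proof -
  have "\<bar>x\<bar> \<le> \<bar>\<bar>x\<bar>\<bar>" "\<bar>\<bar>x\<bar>\<bar> \<le> \<bar>x\<bar>" by simp_all
  with assms show ?thesis unfolding lattice_ideal_def by blast
qed

text \<open>
  This reduces invariance to generators: if \<open>J\<close> is generated, as a closed ideal, by positive
  vectors that \<open>T\<close> sends into \<open>J\<close>, then the closed ideal below contains these vectors and hence
  all of \<open>J\<close>.
\<close>

lemma closed_ideal_pullback:
  assumes T: "positive_op T" and J: "lattice_ideal J" "closed J"
  shows "lattice_ideal {u. T \<bar>u\<bar> \<in> J}" "closed {u. T \<bar>u\<bar> \<in> J}"
proof -
  have bl: "bounded_linear T" by (rule positive_op_bounded_linear[OF T])
  have sub: "subspace J" using J(1) by (simp add: lattice_ideal_def)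
  have cl: "closed {x. T x \<in> J}"
    using continuous_closed_vimage[OF J(2), of T] linear_continuous_at[OF bl]
    by (simp add: vimage_def)
  have lin: "linear T" using bl by (rule bounded_linear.linear)
  have K: "0 \<in> {x. T x \<in> J}"
    "\<And>x y. x \<in> {x. T x \<in> J} \<Longrightarrow> y \<in> {x. T x \<in> J} \<Longrightarrow> x + y \<in> {x. T x \<in> J}"
    "\<And>c x. x \<in> {x. T x \<in> J} \<Longrightarrow> c *\<^sub>R x \<in> {x. T x \<in> J}"
    "\<And>x y. 0 \<le> x \<Longrightarrow> x \<le> y \<Longrightarrow> y \<in> {x. T x \<in> J} \<Longrightarrow> x \<in> {x. T x \<in> J}"
  proof -
    fix x y assume "0 \<le> x" "x \<le> y" "y \<in> {x. T x \<in> J}"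
    with T show "x \<in> {x. T x \<in> J}"
      using lattice_ideal_hereditary[OF J(1) _ positive_op_mono[OF T]]
      by (auto simp: positive_op_def)
  qed (use sub lin in \<open>auto simp: linear_0 linear_add linear_scale subspace_0 subspace_add subspace_scale\<close>)
  from closed_ideal_of_hereditary_set[OF cl K]
  show "lattice_ideal {u. T \<bar>u\<bar> \<in> J}" "closed {u. T \<bar>u\<bar> \<in> J}" by simp_all
qed

lemma positive_op_in_ideal:
  assumes "positive_op T" "lattice_ideal J" "T \<bar>u\<bar> \<in> J"
  shows "T u \<in> J"
  using lattice_ideal_hereditary[OF assms(2) abs_ge_zero positive_op_abs_le[OF assms(1)] assms(3)]
  by (simp add: lattice_ideal_abs[OF assms(2)])

lemma linear_funpow:
  fixes f :: "'a::real_vector \<Rightarrow> 'a"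
  assumes "linear f"
  shows "linear (f ^^ n)"
proof (induction n)
  case (Suc n)
  from linear_compose[OF Suc assms] show ?case by (simp add: o_def)
qed (simp add: linear_id[unfolded id_def])

lemma positive_op_funpow_nonneg: "positive_op B \<Longrightarrow> 0 \<le> x \<Longrightarrow> 0 \<le> (B ^^ n) x"
  by (induction n) (simp_all add: positive_op_def)

lemma positive_op_funpow_mono: "positive_op B \<Longrightarrow> x \<le> y \<Longrightarrow> (B ^^ n) x \<le> (B ^^ n) y"
  by (induction n) (simp_all add: positive_op_mono)

text \<open>
  Through this trivial case, whatever is proved below for the operators semi-commuting with
  \<open>volterra\<close> or with a Donoghue operator also applies to those two operators themselves.
\<close>

lemma semi_commute_self: "semi_commute A A"
  by (simp add: semi_commute_def op_ge_def positive_op_def linear_zero)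

text \<open>
  Positivity of \<open>B\<close> lets an inequality between \<open>A \<circ> B\<close> and \<open>B \<circ> A\<close> be used once for each factor
  of a power of \<open>B\<close>. In the applications \<open>B\<close> is concrete and its powers are known explicitly, while
  nothing is known about \<open>A\<close> beyond positivity.
\<close>

lemma funpow_semi_commute_ge:
  assumes B: "positive_op B" and ge: "op_ge (A \<circ> B) (B \<circ> A)" and x: "0 \<le> x"
  shows "(B ^^ n) (A x) \<le> A ((B ^^ n) x)"
proof (induction n)
  case (Suc n)
  have "(B ^^ Suc n) (A x) \<le> B (A ((B ^^ n) x))"
    using positive_op_mono[OF B Suc.IH] by simp
  also have "\<dots> \<le> A (B ((B ^^ n) x))"
    using ge positive_op_funpow_nonneg[OF B x, of n] by (auto simp: op_ge_def positive_op_def)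
  finally show ?case by simp
qed simp

lemma funpow_semi_commute_le:
  assumes B: "positive_op B" and le: "op_ge (B \<circ> A) (A \<circ> B)" and x: "0 \<le> x"
  shows "A ((B ^^ n) x) \<le> (B ^^ n) (A x)"
proof (induction n)
  case (Suc n)
  have "A ((B ^^ Suc n) x) \<le> B (A ((B ^^ n) x))"
    using le positive_op_funpow_nonneg[OF B x, of n] by (auto simp: op_ge_def positive_op_def)
  also have "\<dots> \<le> (B ^^ Suc n) (A x)"
    using positive_op_mono[OF B Suc.IH] by simp
  finally show ?case by simp
qed simp

lemma maxchain_of_closed_idealsI:
  assumes "\<And>J. J \<in> C \<Longrightarrow> lattice_ideal J \<and> closed J"
    and "\<And>J K. J \<in> C \<Longrightarrow> K \<in> C \<Longrightarrow> J \<subseteq> K \<or> K \<subseteq> J"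
    and max: "\<And>K. lattice_ideal K \<Longrightarrow> closed K \<Longrightarrow> (\<And>J. J \<in> C \<Longrightarrow> K \<subseteq> J \<or> J \<subseteq> K) \<Longrightarrow> K \<in> C"
  shows "subset.maxchain {J. lattice_ideal J \<and> closed J} C"
proof -
  have "subset.chain {J. lattice_ideal J \<and> closed J} C"
    unfolding subset_chain_def using assms(1,2) by blast
  moreover have "D \<subseteq> C" if "subset.chain {J. lattice_ideal J \<and> closed J} D" "C \<subseteq> D" for D
  proof
    fix K assume K: "K \<in> D"
    show "K \<in> C"
    proof (rule max)
      show "lattice_ideal K" "closed K"
        using that(1) K by (auto simp: subset_chain_def)
      show "K \<subseteq> J \<or> J \<subseteq> K" if "J \<in> C" for J
        using \<open>subset.chain _ D\<close> \<open>C \<subseteq> D\<close> K that unfolding subset_chain_def by blast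
    qed
  qed
  ultimately show ?thesis by (auto simp: subset.maxchain_def psubset_eq)
qed

lemma nonpos_of_geometric_bound:
  fixes c C r :: real
  assumes "0 \<le> r" "r < 1" "\<And>n. c \<le> C * r ^ Suc n"
  shows "c \<le> 0"
proof (rule LIMSEQ_le_const)
  have "(\<lambda>n. r ^ Suc n) \<longlonglongrightarrow> 0"
    using LIMSEQ_power_zero[of r] assms(1,2) by (intro LIMSEQ_Suc) simp
  from tendsto_mult_left[OF this, of C]
  show "(\<lambda>n. C * r ^ Suc n) \<longlonglongrightarrow> 0" by simp
  show "\<exists>N. \<forall>n\<ge>N. c \<le> C * r ^ Suc n" using assms(3) by auto
qed

section \<open>Powers of the Volterra operator\<close>

lemma square_integrable_bounded_leb01:
  assumes "f \<in> borel_measurable leb01" "\<And>x. x \<in> {0..1} \<Longrightarrow> \<bar>f x\<bar> \<le> B"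
  shows "square_integrable leb01 f"
proof (rule square_integrable_bounded[OF assms(1)])
  show "integrable leb01 (\<lambda>_. B\<^sup>2)"
    using finite_measure_leb01 by (simp add: finite_measure.integrable_const)
  have "(f x)\<^sup>2 \<le> B\<^sup>2" if "x \<in> {0..1}" for x
    using power_mono[OF assms(2)[OF that], of 2] by simp
  then show "AE x in leb01. (f x)\<^sup>2 \<le> B\<^sup>2" by (intro AE_I2) simp
qed

lemma square_integrable_continuous_leb01:
  fixes f :: "real \<Rightarrow> real"
  assumes "continuous_on {0..1} f"
  shows "square_integrable leb01 f"
proof -
  obtain B where "\<And>x. x \<in> {0..1} \<Longrightarrow> norm (f x) \<le> B"
    using compact_imp_bounded[OF compact_continuous_image[OF assms]] unfolding bounded_iff by blast
  then show ?thesis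
    using continuous_imp_measurable_on_sets_lebesgue[OF assms]
    by (intro square_integrable_bounded_leb01) auto
qed

lemma L2_class_eqI:
  assumes "square_integrable leb01 f" "square_integrable leb01 g" "\<And>x. x \<in> {0..1} \<Longrightarrow> f x = g x"
  shows "L2_class f = L2_class g"
proof -
  have "L2_rel f g" unfolding L2_rel_def using assms by (auto intro!: AE_I2)
  then show ?thesis using Quotient3_rel[OF Quotient3_L2_01, of f g] assms(1,2) by (simp add: L2_rel_refl)
qed

lemma L2_class_leI:
  assumes "square_integrable leb01 f" "square_integrable leb01 g" "\<And>x. x \<in> {0..1} \<Longrightarrow> f x \<le> g x"
  shows "L2_class f \<le> L2_class g"
  using assms by (auto simp: less_eq_L2_01.abs_eq L2_rel_refl intro!: AE_I2)

lemma L2_class_scale: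
  "square_integrable leb01 f \<Longrightarrow> c *\<^sub>R L2_class f = L2_class (\<lambda>x. c * f x)"
  by (simp add: scaleR_L2_01.abs_eq L2_rel_refl)

lemma inner_nonneg_L2:
  fixes u v :: L2_01
  assumes "0 \<le> u" "0 \<le> v"
  shows "0 \<le> inner u v"
  using assms
proof transfer
  fix f g :: "real \<Rightarrow> real"
  assume "AE x in leb01. 0 \<le> f x" "AE x in leb01. 0 \<le> g x"
  then show "0 \<le> integral\<^sup>L leb01 (\<lambda>x. f x * g x)"
    by (intro integral_nonneg_AE) (auto elim!: eventually_elim2)
qed

lemma inner_mono_L2:
  fixes u v w :: L2_01
  assumes "u \<le> v" "0 \<le> w"
  shows "inner u w \<le> inner v w"
  using inner_nonneg_L2[of "v - u" w] assms by (simp add: inner_diff_left)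

definition init_indicator :: "real \<Rightarrow> L2_01" where
  "init_indicator c = L2_class (\<lambda>x. if x \<le> c then 1 else 0)"

text \<open>
  These are the truncated powers \<open>(x - a)\<^sub>+\<^sup>n / n!\<close>. Writing them with \<open>max 0 (x - a)\<close>
  instead would, because of \<open>0 ^ 0 = 1\<close>, give the constant function for \<open>n = 0\<close>, where the
  indicator of \<open>{a..}\<close> is wanted: for \<open>a \<ge> 0\<close>, applying the Volterra operator \<open>n\<close> times to this
  indicator produces \<open>ramp a n\<close>.
\<close>

definition ramp :: "real \<Rightarrow> nat \<Rightarrow> L2_01" where
  "ramp a n = L2_class (\<lambda>x. if a \<le> x then (x - a) ^ n / fact n else 0)"

lemma square_integrable_init_indicator: "square_integrable leb01 (\<lambda>x. if x \<le> c then 1 else 0)"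
proof (rule square_integrable_bounded_leb01[where B = 1])
  have "(\<lambda>x::real. if x \<le> c then 1 else 0 :: real) \<in> borel_measurable borel" by measurable
  then show "(\<lambda>x. if x \<le> c then 1 else 0) \<in> borel_measurable leb01"
    by (intro measurable_restrict_space1 measurable_completion) auto
qed auto

lemma square_integrable_ramp: "square_integrable leb01 (\<lambda>x. if a \<le> x then (x - a) ^ n / fact n else 0)"
proof (rule square_integrable_bounded_leb01)
  have "(\<lambda>x::real. if a \<le> x then (x - a) ^ n / fact n else 0) \<in> borel_measurable borel"
    by measurable
  then show "(\<lambda>x. if a \<le> x then (x - a) ^ n / fact n else 0) \<in> borel_measurable leb01"
    by (intro measurable_restrict_space1 measurable_completion) auto
  fix x :: real assume x: "x \<in> {0..1}"
  show "\<bar>if a \<le> x then (x - a) ^ n / fact n else 0\<bar> \<le> \<bar>1 - a\<bar> ^ n"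
  proof (cases "a \<le> x")
    case True
    have "(x - a) ^ n / fact n \<le> (x - a) ^ n / 1"
      using True by (intro divide_left_mono) (auto simp: fact_ge_1)
    also have "(x - a) ^ n \<le> \<bar>1 - a\<bar> ^ n" using True x by (intro power_mono) auto
    finally show ?thesis using True by simp
  qed simp
qed

lemma init_indicator_nonneg: "0 \<le> init_indicator c"
  unfolding init_indicator_def zero_L2_01_def
  by (rule L2_class_leI[OF _ square_integrable_init_indicator]) (auto simp: square_integrable_def)

lemma init_indicator_mono: "b \<le> c \<Longrightarrow> init_indicator b \<le> init_indicator c"
  unfolding init_indicator_def
  by (rule L2_class_leI[OF square_integrable_init_indicator square_integrable_init_indicator]) auto

lemma ramp_nonneg: "0 \<le> ramp a n"
  unfolding ramp_def zero_L2_01_def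
  by (rule L2_class_leI[OF _ square_integrable_ramp]) (auto simp: square_integrable_def)

text \<open>
  The primitive of \<open>f\<close> at \<open>x\<close> is thus a positive linear functional of the class of \<open>f\<close>, so that
  linearity and order properties of \<open>volterra\<close> can be read off from the inner product.
\<close>

lemma inner_init_indicator:
  assumes "square_integrable leb01 f" "x \<in> {0..1}"
  shows "inner (L2_class f) (init_indicator x) = integral\<^sup>L (lebesgue_on {0..x}) f"
proof -
  have "inner (L2_class f) (init_indicator x) = integral\<^sup>L leb01 (\<lambda>t. f t * (if t \<le> x then 1 else 0))"
    unfolding init_indicator_def
    by (rule inner_L2_01.abs_eq) (simp_all add: L2_rel_refl assms square_integrable_init_indicator)
  also have "\<dots> = integral\<^sup>L lebesgue (\<lambda>t. indicator {0..1} t *\<^sub>R (f t * (if t \<le> x then 1 else 0)))"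
    by (rule integral_restrict_space) simp
  also have "\<dots> = integral\<^sup>L lebesgue (\<lambda>t. indicator {0..x} t *\<^sub>R f t)"
    by (rule Bochner_Integration.integral_cong) (use assms(2) in \<open>auto simp: indicator_def\<close>)
  also have "\<dots> = integral\<^sup>L (lebesgue_on {0..x}) f"
    by (rule integral_restrict_space[symmetric]) simp
  finally show ?thesis .
qed

lemma integrable_lebesgue_on_initial:
  assumes "square_integrable leb01 f" "x \<in> {0..1}"
  shows "integrable (lebesgue_on {0..x}) f"
  by (rule integrable_subinterval[OF integrable_of_square_integrable_leb01[OF assms(1)]])
    (use assms(2) in auto)

lemma continuous_on_inner_init_indicator:
  "continuous_on {0..1} (\<lambda>x. inner u (init_indicator x))"
proof -
  note f = square_integrable_L2_rep[of u]
  have "continuous_on {0..1} (\<lambda>x. Henstock_Kurzweil_Integration.integral {0..x} (L2_rep u))"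
    using integrable_of_square_integrable_leb01[OF f]
    by (intro indefinite_integral_continuous_1 integrable_on_lebesgue_on) auto
  moreover have "inner u (init_indicator x) = Henstock_Kurzweil_Integration.integral {0..x} (L2_rep u)"
    if "x \<in> {0..1}" for x
    using inner_init_indicator[OF f that] lebesgue_integral_eq_integral[OF integrable_lebesgue_on_initial[OF f that]]
    by (simp add: L2_class_rep)
  ultimately show ?thesis by (subst continuous_on_cong[OF refl]) auto
qed

lemma square_integrable_inner_init_indicator:
  "square_integrable leb01 (\<lambda>x. inner u (init_indicator x))"
  by (rule square_integrable_continuous_leb01[OF continuous_on_inner_init_indicator])

lemma volterra_eq: "volterra u = L2_class (\<lambda>x. inner u (init_indicator x))"
proof -
  note f = square_integrable_L2_rep[of u]
  have eq: "inner u (init_indicator x) = integral\<^sup>L (lebesgue_on {0..x}) (L2_rep u)" if "x \<in> {0..1}" for x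
    using inner_init_indicator[OF f that] by (simp add: L2_class_rep)
  have "volterra u = volterra (L2_class (L2_rep u))" by (simp add: L2_class_rep)
  also have "\<dots> = L2_class (\<lambda>x. integral\<^sup>L (lebesgue_on {0..x}) (L2_rep u))"
    by (rule volterra.abs_eq) (simp add: L2_rel_refl f)
  also have "\<dots> = L2_class (\<lambda>x. inner u (init_indicator x))"
  proof (rule L2_class_eqI[OF _ square_integrable_inner_init_indicator])
    have "continuous_on {0..1} (\<lambda>x. integral\<^sup>L (lebesgue_on {0..x}) (L2_rep u))"
      using continuous_on_inner_init_indicator[of u] by (subst continuous_on_cong[OF refl eq[symmetric]]) auto
    then show "square_integrable leb01 (\<lambda>x. integral\<^sup>L (lebesgue_on {0..x}) (L2_rep u))"
      by (rule square_integrable_continuous_leb01)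
  qed (simp add: eq)
  finally show ?thesis .
qed

lemma positive_op_volterra: "positive_op volterra"
  unfolding positive_op_def
proof (intro conjI allI impI linearI)
  fix u v :: L2_01 and c :: real
  show "volterra (u + v) = volterra u + volterra v"
    unfolding volterra_eq inner_add_left
    by (rule plus_L2_01.abs_eq[symmetric]) (simp_all add: L2_rel_refl square_integrable_inner_init_indicator)
  show "volterra (c *\<^sub>R u) = c *\<^sub>R volterra u"
    unfolding volterra_eq inner_scaleR_left L2_class_scale[OF square_integrable_inner_init_indicator] ..
  show "0 \<le> volterra u" if "0 \<le> u"
    unfolding volterra_eq zero_L2_01_def
    by (rule L2_class_leI[OF _ square_integrable_inner_init_indicator])
      (simp_all add: square_integrable_def inner_nonneg_L2 that init_indicator_nonneg)
qed

text \<open>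
  The primitive of a nonnegative function is increasing, so from \<open>b\<close> onwards it is at least its
  value at \<open>b\<close>. This turns a mass on \<open>[0,b]\<close> into a multiple of an indicator function, on which the
  powers of the Volterra operator are explicit.
\<close>

lemma volterra_ge:
  assumes "0 \<le> u"
  shows "inner u (init_indicator b) *\<^sub>R ramp b 0 \<le> volterra u"
  unfolding volterra_eq ramp_def L2_class_scale[OF square_integrable_ramp]
proof (rule L2_class_leI[OF square_integrable_cmult[OF square_integrable_ramp] square_integrable_inner_init_indicator])
  fix x :: real
  have "inner u (init_indicator b) \<le> inner u (init_indicator x)" if "b \<le> x"
    using inner_mono_L2[OF init_indicator_mono[OF that] assms] by (simp add: inner_commute)
  then show "inner u (init_indicator b) * (if b \<le> x then (x - b) ^ 0 / fact 0 else 0) \<le> inner u (init_indicator x)"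
    using inner_nonneg_L2[OF assms init_indicator_nonneg] by auto
qed

lemma volterra_le:
  assumes "0 \<le> u"
  shows "volterra u \<le> inner u (init_indicator 1) *\<^sub>R ramp 0 0"
  unfolding volterra_eq ramp_def L2_class_scale[OF square_integrable_ramp]
proof (rule L2_class_leI[OF square_integrable_inner_init_indicator square_integrable_cmult[OF square_integrable_ramp]])
  fix x :: real assume "x \<in> {0..1}"
  then show "inner u (init_indicator x) \<le> inner u (init_indicator 1) * (if 0 \<le> x then (x - 0) ^ 0 / fact 0 else 0)"
    using inner_mono_L2[OF init_indicator_mono assms, of x 1] by (simp add: inner_commute)
qed

lemma inner_ramp_init_indicator:
  assumes "0 \<le> a" "x \<in> {0..1}"
  shows "inner (ramp a n) (init_indicator x) = (if a \<le> x then (x - a) ^ Suc n / fact (Suc n) else 0)"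
proof -
  let ?f = "\<lambda>t::real. if a \<le> t then (t - a) ^ n / fact n else 0"
  have "inner (ramp a n) (init_indicator x) = integral\<^sup>L (lebesgue_on {0..x}) ?f"
    unfolding ramp_def by (rule inner_init_indicator[OF square_integrable_ramp assms(2)])
  also have "\<dots> = Henstock_Kurzweil_Integration.integral {0..x} ?f"
    by (rule lebesgue_integral_eq_integral[OF integrable_lebesgue_on_initial[OF square_integrable_ramp assms(2)]]) simp
  also have "\<dots> = (if a \<le> x then (x - a) ^ Suc n / fact (Suc n) else 0)"
  proof (cases "a \<le> x")
    case True
    have "((\<lambda>t. (t - a) ^ n / fact n) has_integral ((x - a) ^ Suc n / fact (Suc n) - (a - a) ^ Suc n / fact (Suc n))) {a..x}"
    proof (rule fundamental_theorem_of_calculus[OF True])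
      fix t :: real
      have "((\<lambda>t. (t - a) ^ Suc n / fact (Suc n)) has_real_derivative
            (real (Suc n) * (t - a) ^ n) / fact (Suc n)) (at t within {a..x})"
        by (auto intro!: derivative_eq_intros simp del: power_Suc fact_Suc)
      then show "((\<lambda>t. (t - a) ^ Suc n / fact (Suc n)) has_vector_derivative (t - a) ^ n / fact n) (at t within {a..x})"
        by (simp add: has_real_derivative_iff_has_vector_derivative del: power_Suc of_nat_Suc)
    qed
    then have "((\<lambda>t. (t - a) ^ n / fact n) has_integral ((x - a) ^ Suc n / fact (Suc n))) {a..x}" by simp
    then have "((\<lambda>t. if t \<in> {a..x} then (t - a) ^ n / fact n else 0) has_integral ((x - a) ^ Suc n / fact (Suc n))) {0..x}"
      using assms(1) by (subst has_integral_restrict) auto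
    then have "(?f has_integral ((x - a) ^ Suc n / fact (Suc n))) {0..x}"
      by (rule has_integral_eq[rotated]) auto
    with True show ?thesis by (simp add: integral_unique del: power_Suc fact_Suc)
  next
    case False
    then have "Henstock_Kurzweil_Integration.integral {0..x} ?f = Henstock_Kurzweil_Integration.integral {0..x} (\<lambda>_. 0)"
      by (intro Henstock_Kurzweil_Integration.integral_cong) auto
    with False show ?thesis by simp
  qed
  finally show ?thesis .
qed

lemma volterra_ramp:
  assumes "0 \<le> a"
  shows "volterra (ramp a n) = ramp a (Suc n)"
  unfolding volterra_eq ramp_def[of a "Suc n"]
  by (rule L2_class_eqI[OF square_integrable_inner_init_indicator square_integrable_ramp])
    (rule inner_ramp_init_indicator[OF assms])

lemma volterra_funpow_ramp: "0 \<le> a \<Longrightarrow> (volterra ^^ n) (ramp a 0) = ramp a n"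
  by (induction n) (simp_all add: volterra_ramp)

lemma ramp_le:
  assumes "a \<le> 1"
  shows "ramp a n \<le> ((1 - a) ^ n / fact n) *\<^sub>R ramp 0 0"
  unfolding ramp_def L2_class_scale[OF square_integrable_ramp]
  by (rule L2_class_leI[OF square_integrable_ramp square_integrable_cmult[OF square_integrable_ramp]])
    (use assms in \<open>auto intro!: divide_right_mono power_mono\<close>)

lemma ramp_ge:
  assumes "0 \<le> b"
  shows "(b ^ n / fact n) *\<^sub>R ramp b 0 \<le> ramp 0 n"
  unfolding ramp_def L2_class_scale[OF square_integrable_ramp]
  by (rule L2_class_leI[OF square_integrable_cmult[OF square_integrable_ramp] square_integrable_ramp])
    (use assms in \<open>auto intro!: divide_right_mono power_mono\<close>)

text \<open>
  This is where semi-commutation is exploited. Let \<open>c\<close> be the mass on \<open>[0,b]\<close> of the image under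
  \<open>T\<close> of the indicator of \<open>[a,1]\<close>, with \<open>b < a\<close>. An inequality between \<open>V\<^sup>n T\<close> and \<open>T V\<^sup>n\<close> pits
  powers of two lengths against each other, with the factorials cancelling; the constant \<open>C\<close> is
  the integral of \<open>T 1\<close> over \<open>[0,1]\<close>.

  If \<open>V T \<le> T V\<close>, then applying \<open>V\<^sup>n\<^sup>+\<^sup>1 T\<close> to the indicator of \<open>[a,1]\<close> spreads the mass \<open>c\<close> over a
  ramp that starts at \<open>b\<close>, whereas \<open>T V\<^sup>n\<^sup>+\<^sup>1\<close> only sees a ramp starting at \<open>a\<close>: integration over
  \<open>[0,1]\<close> gives \<open>c (1 - b)\<^sup>n\<^sup>+\<^sup>1 \<le> C (1 - a)\<^sup>n\<^sup>+\<^sup>1\<close>.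

  If \<open>T V \<le> V T\<close>, both sides are applied to the constant function \<open>1\<close>. Its image under \<open>V\<^sup>n\<^sup>+\<^sup>1\<close> is
  at least \<open>a\<^sup>n\<^sup>+\<^sup>1 / (n+1)!\<close> on \<open>[a,1]\<close>, whereas \<open>V\<^sup>n\<^sup>+\<^sup>1 T\<close> yields at most a multiple of
  \<open>x\<^sup>n / n!\<close>: integration over \<open>[0,b]\<close> gives \<open>c a\<^sup>n\<^sup>+\<^sup>1 \<le> C b\<^sup>n\<^sup>+\<^sup>1\<close>.
\<close>

lemma inner_op_ramp_init_indicator_nonpos:
  assumes T: "positive_op T" and sc: "semi_commute T volterra" and ab: "0 \<le> b" "b < a" "a \<le> 1"
  shows "inner (T (ramp a 0)) (init_indicator b) \<le> 0"
proof -
  let ?V = volterra and ?one = "ramp 0 0"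
  define c where "c = inner (T (ramp a 0)) (init_indicator b)"
  define C where "C = inner (T ?one) (init_indicator 1)"
  note V = positive_op_volterra
  have lin: "linear T" using T by (simp add: positive_op_def)
  have linV: "linear (?V ^^ n)" for n
    using V by (intro linear_funpow) (simp add: positive_op_def)
  have Tpos: "0 \<le> T (ramp d n)" for d n
    using T ramp_nonneg by (simp add: positive_op_def)
  have "c \<le> 0"
    using sc unfolding semi_commute_def
  proof
    assume ge: "op_ge (T \<circ> ?V) (?V \<circ> T)"
    have "c \<le> C * ((1 - a) / (1 - b)) ^ Suc n" for n
    proof -
      have "c *\<^sub>R ramp b n = (?V ^^ n) (c *\<^sub>R ramp b 0)"
        using ab by (simp add: linear_scale[OF linV] volterra_funpow_ramp)
      also have "\<dots> \<le> (?V ^^ n) (?V (T (ramp a 0)))"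
        unfolding c_def by (rule positive_op_funpow_mono[OF V volterra_ge[OF Tpos]])
      also have "\<dots> = (?V ^^ Suc n) (T (ramp a 0))" by (simp add: funpow_swap1)
      also have "\<dots> \<le> T ((?V ^^ Suc n) (ramp a 0))"
        by (rule funpow_semi_commute_ge[OF V ge ramp_nonneg])
      also have "\<dots> = T (ramp a (Suc n))" using ab by (subst volterra_funpow_ramp) auto
      also have "\<dots> \<le> T (((1 - a) ^ Suc n / fact (Suc n)) *\<^sub>R ?one)"
        by (rule positive_op_mono[OF T ramp_le[OF ab(3)]])
      also have "\<dots> = ((1 - a) ^ Suc n / fact (Suc n)) *\<^sub>R T ?one" by (rule linear_scale[OF lin])
      finally have "inner (c *\<^sub>R ramp b n) (init_indicator 1) \<le>
          inner (((1 - a) ^ Suc n / fact (Suc n)) *\<^sub>R T ?one) (init_indicator 1)"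
        by (rule inner_mono_L2[OF _ init_indicator_nonneg])
      then have "c * (1 - b) ^ Suc n / fact (Suc n) \<le> C * (1 - a) ^ Suc n / fact (Suc n)"
        using ab by (simp add: inner_ramp_init_indicator C_def mult.commute del: power_Suc fact_Suc)
      then have "c * (1 - b) ^ Suc n \<le> C * (1 - a) ^ Suc n"
        by (simp add: divide_le_cancel del: power_Suc fact_Suc)
      then show ?thesis using ab by (simp add: power_divide pos_le_divide_eq del: power_Suc)
    qed
    then show "c \<le> 0" by (rule nonpos_of_geometric_bound[rotated 2]) (use ab in auto)
  next
    assume le: "op_ge (?V \<circ> T) (T \<circ> ?V)"
    have "c \<le> C * (b / a) ^ Suc n" for n
    proof -
      have "(a ^ Suc n / fact (Suc n)) *\<^sub>R T (ramp a 0) = T ((a ^ Suc n / fact (Suc n)) *\<^sub>R ramp a 0)"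
        by (rule linear_scale[OF lin, symmetric])
      also have "\<dots> \<le> T (ramp 0 (Suc n))" by (rule positive_op_mono[OF T ramp_ge]) (use ab in simp)
      also have "\<dots> = T ((?V ^^ Suc n) ?one)" by (subst volterra_funpow_ramp) auto
      also have "\<dots> \<le> (?V ^^ Suc n) (T ?one)"
        by (rule funpow_semi_commute_le[OF V le ramp_nonneg])
      also have "\<dots> = (?V ^^ n) (?V (T ?one))" by (simp add: funpow_swap1)
      also have "\<dots> \<le> (?V ^^ n) (C *\<^sub>R ?one)"
        unfolding C_def by (rule positive_op_funpow_mono[OF V volterra_le[OF Tpos]])
      also have "\<dots> = C *\<^sub>R ramp 0 n" by (simp add: linear_scale[OF linV] volterra_funpow_ramp)
      finally have "inner ((a ^ Suc n / fact (Suc n)) *\<^sub>R T (ramp a 0)) (init_indicator b) \<le>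
          inner (C *\<^sub>R ramp 0 n) (init_indicator b)"
        by (rule inner_mono_L2[OF _ init_indicator_nonneg])
      then have "c * a ^ Suc n / fact (Suc n) \<le> C * b ^ Suc n / fact (Suc n)"
        using ab by (simp add: inner_ramp_init_indicator c_def mult.commute del: power_Suc fact_Suc)
      then have "c * a ^ Suc n \<le> C * b ^ Suc n"
        by (simp add: divide_le_cancel del: power_Suc fact_Suc)
      then show ?thesis using ab by (simp add: power_divide pos_le_divide_eq del: power_Suc)
    qed
    then show "c \<le> 0" by (rule nonpos_of_geometric_bound[rotated 2]) (use ab in auto)
  qed
  then show ?thesis by (simp add: c_def)
qed

section \<open>The closed ideals of functions vanishing on an initial interval\<close>

text \<open>
  The condition says that \<open>u = 0\<close> almost everywhere on \<open>[0,a]\<close>. It is expressed by an integral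
  because this depends continuously on \<open>u\<close> and on \<open>a\<close> in \<open>[0,1]\<close>.
\<close>

definition vanishing_ideal :: "real \<Rightarrow> L2_01 set" where
  "vanishing_ideal a = {u. inner \<bar>u\<bar> (init_indicator a) = 0}"

lemma vanishing_ideal_closed_ideal: "lattice_ideal (vanishing_ideal a)" "closed (vanishing_ideal a)"
proof -
  let ?K = "{u. inner u (init_indicator a) = 0}"
  have "closed ?K" by (intro closed_Collect_eq continuous_intros)
  moreover have "x \<in> ?K" if "0 \<le> x" "x \<le> y" "y \<in> ?K" for x y
    using inner_mono_L2[OF that(2) init_indicator_nonneg, of a] that(3)
      inner_nonneg_L2[OF that(1) init_indicator_nonneg, of a] by simp
  ultimately show "lattice_ideal (vanishing_ideal a)" "closed (vanishing_ideal a)"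
    using closed_ideal_of_hereditary_set[of ?K] by (simp_all add: vanishing_ideal_def inner_add_left)
qed

lemma vanishing_ideal_antimono:
  assumes "a \<le> b"
  shows "vanishing_ideal b \<subseteq> vanishing_ideal a"
proof
  fix u assume "u \<in> vanishing_ideal b"
  moreover have "inner \<bar>u\<bar> (init_indicator a) \<le> inner \<bar>u\<bar> (init_indicator b)"
    using inner_mono_L2[OF init_indicator_mono[OF assms] abs_ge_zero[of u]] by (simp add: inner_commute)
  moreover have "0 \<le> inner \<bar>u\<bar> (init_indicator a)"
    by (rule inner_nonneg_L2[OF abs_ge_zero init_indicator_nonneg])
  ultimately show "u \<in> vanishing_ideal a" by (simp add: vanishing_ideal_def)
qed

lemma ramp_in_vanishing_ideal: "a \<in> {0..1} \<Longrightarrow> ramp a 0 \<in> vanishing_ideal a"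
  by (simp add: vanishing_ideal_def abs_of_nonneg[OF ramp_nonneg] inner_ramp_init_indicator)

lemma closed_inner_init_indicator_zeros: "closed {x \<in> {0..1}. inner u (init_indicator x) = 0}"
  by (intro continuous_closed_preimage_constant continuous_on_inner_init_indicator) simp

lemma vanishing_ideal_zero: "vanishing_ideal 0 = UNIV"
proof -
  have "inner \<bar>u\<bar> (init_indicator 0) = 0" for u :: L2_01
    using inner_init_indicator[OF square_integrable_L2_rep, of 0 "\<bar>u\<bar>"]
      lebesgue_integral_eq_integral[OF integrable_lebesgue_on_initial[OF square_integrable_L2_rep, of 0 "\<bar>u\<bar>"]]
    by (simp add: L2_class_rep)
  then show ?thesis by (simp add: vanishing_ideal_def)
qed

lemma vanishing_ideal_left_limit:
  assumes "0 \<le> a" "a \<le> 1" "\<And>b. 0 \<le> b \<Longrightarrow> b < a \<Longrightarrow> u \<in> vanishing_ideal b"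
  shows "u \<in> vanishing_ideal a"
proof (cases "a = 0")
  case True
  then show ?thesis by (simp add: vanishing_ideal_zero)
next
  case False
  let ?Z = "{x \<in> {0..1}. inner \<bar>u\<bar> (init_indicator x) = 0}"
  have "{0..<a} \<subseteq> ?Z" using assms by (auto simp: vanishing_ideal_def)
  then have "closure {0..<a} \<subseteq> ?Z"
    by (rule closure_minimal) (rule closed_inner_init_indicator_zeros)
  then have "a \<in> ?Z" using False assms(1) by (simp add: subset_iff)
  then show ?thesis by (simp add: vanishing_ideal_def)
qed

lemma inner_ramp_ramp:
  assumes "0 \<le> a" "a \<le> b" "b \<le> 1"
  shows "inner (ramp a 0) (ramp b 0) = 1 - b"
proof -
  have "inner (ramp a 0) (ramp b 0) = inner (ramp b 0) (init_indicator 1)"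
    unfolding ramp_def init_indicator_def
    by (subst (1 2) inner_L2_01.abs_eq)
      (use assms in \<open>auto simp: L2_rel_refl square_integrable_init_indicator
        intro!: Bochner_Integration.integral_cong square_integrable_ramp[where n = 0, simplified]\<close>)
  also have "\<dots> = 1 - b" using assms by (simp add: inner_ramp_init_indicator)
  finally show ?thesis .
qed

lemma norm_ramp_diff:
  assumes "0 \<le> a" "a \<le> b" "b \<le> 1"
  shows "norm (ramp b 0 - ramp a 0) = sqrt (b - a)"
proof -
  have "inner (ramp b 0 - ramp a 0) (ramp b 0 - ramp a 0) = b - a"
    using assms by (simp add: inner_diff_left inner_diff_right inner_ramp_ramp
      inner_commute[of "ramp b 0" "ramp a 0"])
  then show ?thesis by (simp add: norm_eq_sqrt_inner)
qed

text \<open>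
  The truncations of \<open>\<bar>u\<bar>\<close> at the levels \<open>n\<close> converge pointwise to \<open>\<bar>u\<bar>\<close> on \<open>[a,1]\<close>, and on \<open>[0,a]\<close>
  everything vanishes; \<open>\<bar>u\<bar>\<^sup>2\<close> dominates the squared differences.
\<close>

lemma truncation_tendsto:
  assumes "u \<in> vanishing_ideal a"
  shows "(\<lambda>n. inf \<bar>u\<bar> (real n *\<^sub>R ramp a 0)) \<longlonglongrightarrow> \<bar>u\<bar>"
proof -
  define f where "f = L2_rep u"
  define g where "g n x = min \<bar>f x\<bar> (real n * (if a \<le> x then 1 else 0))" for n x
  have f: "square_integrable leb01 f" unfolding f_def by (rule square_integrable_L2_rep)
  have fm [measurable]: "f \<in> borel_measurable leb01" using f by (simp add: square_integrable_def)
  have r: "square_integrable leb01 (\<lambda>x. if a \<le> x then 1 else 0)"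
    using square_integrable_ramp[of a 0] by (simp cong: if_cong)
  have absf: "square_integrable leb01 (\<lambda>x. \<bar>f x\<bar>)"
    using f by (auto simp: square_integrable_def)
  have u: "\<bar>u\<bar> = L2_class (\<lambda>x. \<bar>f x\<bar>)"
    using abs_L2_01.abs_eq[of f] f by (simp add: L2_rel_refl f_def L2_class_rep)
  have nr: "real n *\<^sub>R ramp a 0 = L2_class (\<lambda>x. real n * (if a \<le> x then 1 else 0))" for n
    using L2_class_scale[OF r] by (simp add: ramp_def cong: if_cong)
  have gs: "square_integrable leb01 (g n)" for n
  proof (rule square_integrable_choose[OF absf square_integrable_cmult[OF r, of "real n"]])
    have "(\<lambda>x. min \<bar>f x\<bar> (real n * (if a \<le> x then 1 else 0))) \<in> borel_measurable leb01"
      by (rule borel_measurable_min)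
        (use absf square_integrable_cmult[OF r, of "real n"] in \<open>simp_all add: square_integrable_def\<close>)
    then show "g n \<in> borel_measurable leb01" by (simp add: g_def[abs_def])
  qed (auto simp: g_def min_def)
  have v: "inf \<bar>u\<bar> (real n *\<^sub>R ramp a 0) = L2_class (g n)" for n
    unfolding u nr g_def
    by (rule inf_L2_01.abs_eq) (use absf square_integrable_cmult[OF r] in \<open>simp_all add: L2_rel_refl\<close>)
  have "AE x in leb01. \<bar>f x\<bar> * (if x \<le> a then 1 else 0) = 0"
  proof (subst integral_nonneg_eq_0_iff_AE[symmetric])
    show "integrable leb01 (\<lambda>x. \<bar>f x\<bar> * (if x \<le> a then 1 else 0))"
      by (rule square_integrable_mult[OF absf square_integrable_init_indicator])
    have "inner \<bar>u\<bar> (init_indicator a) = integral\<^sup>L leb01 (\<lambda>x. \<bar>f x\<bar> * (if x \<le> a then 1 else 0))"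
      unfolding u init_indicator_def
      by (rule inner_L2_01.abs_eq) (simp_all add: L2_rel_refl absf square_integrable_init_indicator)
    with assms show "integral\<^sup>L leb01 (\<lambda>x. \<bar>f x\<bar> * (if x \<le> a then 1 else 0)) = 0"
      by (simp add: vanishing_ideal_def)
  qed auto
  then have zero: "AE x in leb01. x \<le> a \<longrightarrow> f x = 0"
    by eventually_elim (auto split: if_splits)
  have "(\<lambda>n. integral\<^sup>L leb01 (\<lambda>x. (\<bar>f x\<bar> - g n x)\<^sup>2)) \<longlonglongrightarrow> integral\<^sup>L leb01 (\<lambda>_. 0)"
  proof (rule integral_dominated_convergence[where w = "\<lambda>x. (f x)\<^sup>2"])
    show "integrable leb01 (\<lambda>x. (f x)\<^sup>2)" using f by (simp add: square_integrable_def)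
    show "AE x in leb01. (\<lambda>n. (\<bar>f x\<bar> - g n x)\<^sup>2) \<longlonglongrightarrow> 0"
      using zero
    proof eventually_elim
      case (elim x)
      obtain N :: nat where N: "\<bar>f x\<bar> \<le> real N" using real_arch_simple by blast
      have "(\<bar>f x\<bar> - g n x)\<^sup>2 = 0" if "n \<ge> N" for n
        using elim N that by (cases "a \<le> x") (auto simp: g_def)
      then show ?case by (intro tendsto_eventually eventually_sequentiallyI)
    qed
    show "AE x in leb01. norm ((\<bar>f x\<bar> - g n x)\<^sup>2) \<le> (f x)\<^sup>2" for n
    proof (rule AE_I2)
      fix x
      have "\<bar>\<bar>f x\<bar> - g n x\<bar> \<le> \<bar>f x\<bar>" by (auto simp: g_def min_def)
      then show "norm ((\<bar>f x\<bar> - g n x)\<^sup>2) \<le> (f x)\<^sup>2" by (simp add: abs_le_square_iff)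
    qed
    show "(\<lambda>x. (\<bar>f x\<bar> - g n x)\<^sup>2) \<in> borel_measurable leb01" for n
      using gs[of n] by (auto simp: square_integrable_def)
  qed simp
  then have "(\<lambda>n. sqrt (integral\<^sup>L leb01 (\<lambda>x. (\<bar>f x\<bar> - g n x)\<^sup>2))) \<longlonglongrightarrow> sqrt 0"
    by (intro tendsto_real_sqrt) simp
  moreover have "norm (L2_class (g n) - \<bar>u\<bar>) = sqrt (integral\<^sup>L leb01 (\<lambda>x. (\<bar>f x\<bar> - g n x)\<^sup>2))" for n
    unfolding u by (subst norm_minus_commute) (rule norm_diff_L2_class[OF absf gs])
  ultimately show ?thesis
    by (subst LIM_zero_iff[symmetric], subst tendsto_norm_zero_iff[symmetric]) (simp add: v)
qed

text \<open>
  The indicator of \<open>[a,1]\<close> is a weak order unit of \<open>vanishing_ideal a\<close>, hence generates it as a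
  closed ideal.
\<close>

lemma vanishing_ideal_generated:
  assumes J: "lattice_ideal J" "closed J" and "ramp a 0 \<in> J"
  shows "vanishing_ideal a \<subseteq> J"
proof
  fix u assume u: "u \<in> vanishing_ideal a"
  have "inf \<bar>u\<bar> (real n *\<^sub>R ramp a 0) \<in> J" for n
  proof (rule lattice_ideal_hereditary[OF J(1)])
    show "0 \<le> inf \<bar>u\<bar> (real n *\<^sub>R ramp a 0)"
      by (simp add: scaleR_nonneg_nonneg ramp_nonneg)
    show "inf \<bar>u\<bar> (real n *\<^sub>R ramp a 0) \<le> real n *\<^sub>R ramp a 0" by simp
    show "real n *\<^sub>R ramp a 0 \<in> J"
      using J(1) assms(3) by (simp add: lattice_ideal_def subspace_scale)
  qed
  then have "\<bar>u\<bar> \<in> J"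
    using closed_sequentially[OF J(2) _ truncation_tendsto[OF u]] by blast
  then show "u \<in> J" by (simp add: lattice_ideal_abs[OF J(1)])
qed

text \<open>
  Let \<open>J\<close> be comparable with every member of the chain, and let \<open>a\<close> be the largest point with
  \<open>J \<subseteq> vanishing_ideal a\<close>. Every \<open>b > a\<close> then satisfies \<open>vanishing_ideal b \<subseteq> J\<close>, so \<open>J\<close> contains
  \<open>ramp b 0\<close>. As \<open>b\<close> decreases to \<open>a\<close>, these converge to \<open>ramp a 0\<close>, which generates
  \<open>vanishing_ideal a\<close>; so \<open>J\<close> is this ideal. The chain has no gaps because the order on \<open>[0,1]\<close> is
  complete and Lebesgue measure has no atoms.
\<close>

lemma maxchain_vanishing_ideals:
  "subset.maxchain {J. lattice_ideal J \<and> closed J} (vanishing_ideal ` {0..1})"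
proof (rule maxchain_of_closed_idealsI)
  show "lattice_ideal J \<and> closed J" if "J \<in> vanishing_ideal ` {0..1}" for J
    using that vanishing_ideal_closed_ideal by blast
  show "J \<subseteq> K \<or> K \<subseteq> J" if "J \<in> vanishing_ideal ` {0..1}" "K \<in> vanishing_ideal ` {0..1}" for J K
    using that vanishing_ideal_antimono by (smt (verit) imageE linear)
next
  fix J assume J: "lattice_ideal J" "closed J"
    and comparable: "\<And>I. I \<in> vanishing_ideal ` {0..1} \<Longrightarrow> J \<subseteq> I \<or> I \<subseteq> J"
  define B where "B = {b \<in> {0..1}. J \<subseteq> vanishing_ideal b}"
  define a where "a = Sup B"
  have B0: "0 \<in> B" by (simp add: B_def vanishing_ideal_zero)
  have bdd: "bdd_above B" by (auto simp: B_def intro: bdd_aboveI[of _ 1])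
  have "closed (\<Inter>u\<in>J. {x \<in> {0..1}. inner \<bar>u\<bar> (init_indicator x) = 0})"
    by (intro closed_INT ballI closed_inner_init_indicator_zeros)
  moreover have "B = {0..1} \<inter> (\<Inter>u\<in>J. {x \<in> {0..1}. inner \<bar>u\<bar> (init_indicator x) = 0})"
    by (auto simp: B_def vanishing_ideal_def)
  ultimately have "closed B" by (simp add: closed_Int)
  with B0 bdd have "a \<in> B" unfolding a_def by (intro closed_contains_Sup) auto
  then have a: "0 \<le> a" "a \<le> 1" "J \<subseteq> vanishing_ideal a" by (auto simp: B_def)
  have "ramp a 0 \<in> J"
    using J(2)
  proof (rule closed_approachable[THEN iffD1], intro allI impI)
    fix e :: real assume "0 < e"
    \<comment> \<open>The distance of \<open>ramp b 0\<close> from \<open>ramp a 0\<close> is \<open>sqrt (b - a)\<close>. For \<open>a = 1\<close> the minimum is \<open>1\<close>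
      and there is no room to the right of \<open>a\<close>, but then \<open>ramp 1 0 = 0\<close>.\<close>
    define b where "b = min 1 (a + e\<^sup>2 / 2)"
    have e2: "0 < e\<^sup>2 / 2" using \<open>0 < e\<close> by simp
    then have b: "a \<le> b" "b \<le> 1" "b - a < e\<^sup>2" using a(2) unfolding b_def by linarith+
    have "ramp b 0 \<in> J"
    proof (cases "a < b")
      case True
      then have "b \<notin> B" using cSup_upper[OF _ bdd, of b] by (auto simp: a_def)
      then have "vanishing_ideal b \<subseteq> J" using comparable[of "vanishing_ideal b"] a b by (auto simp: B_def)
      then show ?thesis using ramp_in_vanishing_ideal[of b] a b by auto
    next
      case False
      with e2 b have "b = 1" by (auto simp: b_def min_def split: if_splits)
      with inner_ramp_ramp[of 1 1] have "ramp b 0 = 0" by simp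
      with J(1) show ?thesis by (simp add: lattice_ideal_def subspace_0)
    qed
    moreover have "dist (ramp b 0) (ramp a 0) < e"
      using norm_ramp_diff[OF a(1) b(1,2)] b(3) \<open>0 < e\<close>
      by (simp add: dist_norm real_less_lsqrt)
    ultimately show "\<exists>y\<in>J. dist y (ramp a 0) < e" by blast
  qed
  then have "J = vanishing_ideal a"
    using vanishing_ideal_generated[OF J] a(3) by blast
  then show "J \<in> vanishing_ideal ` {0..1}" using a by auto
qed

lemma vanishing_ideal_invariant:
  assumes T: "positive_op T" and sc: "semi_commute T volterra" and a: "a \<in> {0..1}"
  shows "T ` vanishing_ideal a \<subseteq> vanishing_ideal a"
proof -
  have pos: "0 \<le> T (ramp a 0)" using T ramp_nonneg by (simp add: positive_op_def)
  have "T (ramp a 0) \<in> vanishing_ideal a"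
  proof (rule vanishing_ideal_left_limit)
    fix b assume "0 \<le> b" "b < a"
    then have "inner (T (ramp a 0)) (init_indicator b) = 0"
      using inner_op_ramp_init_indicator_nonpos[OF T sc, of b a] a inner_nonneg_L2[OF pos init_indicator_nonneg, of b]
      by simp
    then show "T (ramp a 0) \<in> vanishing_ideal b" by (simp add: vanishing_ideal_def pos)
  qed (use a in auto)
  then have "vanishing_ideal a \<subseteq> {u. T \<bar>u\<bar> \<in> vanishing_ideal a}"
    by (intro vanishing_ideal_generated closed_ideal_pullback[OF T vanishing_ideal_closed_ideal])
      (simp add: abs_of_nonneg[OF ramp_nonneg])
  then show ?thesis
    using positive_op_in_ideal[OF T vanishing_ideal_closed_ideal(1)] by blast
qed

lemma volterra_triangularizable:
  assumes "positive_op T" "semi_commute T volterra"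
  shows "ideal_triangularizable {volterra, T}"
  unfolding ideal_triangularizable_def
  using maxchain_vanishing_ideals vanishing_ideal_invariant[OF assms]
    vanishing_ideal_invariant[OF positive_op_volterra semi_commute_self]
  by (intro exI[of _ "vanishing_ideal ` {0..1}"]) auto

section \<open>The Donoghue operator\<close>

text \<open>
  This is the linear span of the first \<open>n\<close> basis vectors, given by coordinates so that
  closedness and solidity are immediate.
\<close>

definition initial_ideal :: "nat \<Rightarrow> ell2 set" where
  "initial_ideal n = {x. \<forall>k\<ge>n. ell2_nth x k = 0}"

lemma ell2_eqI: "(\<And>n. ell2_nth x n = ell2_nth y n) \<Longrightarrow> x = y"
  by (simp add: ell2_nth_inject[symmetric] fun_eq_iff)

lemma bounded_linear_ell2_nth: "bounded_linear (\<lambda>x. ell2_nth x n)"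
  by (rule bounded_linear_intro[where K = 1])
    (simp_all add: plus_ell2.rep_eq scaleR_ell2.rep_eq abs_ell2_nth_le)

lemma ell2_nth_basis: "ell2_nth (ell2_basis k) n = (if n = k then 1 else 0)"
  by (rule ell2_basis.rep_eq[THEN fun_cong])

lemma ell2_basis_nonneg: "0 \<le> ell2_basis k"
  by (simp add: less_eq_ell2.rep_eq zero_ell2.rep_eq ell2_nth_basis)

lemma norm_ell2_basis: "norm (ell2_basis k) = 1"
proof -
  have "(\<Sum>n. (ell2_nth (ell2_basis k) n)\<^sup>2) = (\<Sum>n\<in>{k}. (ell2_nth (ell2_basis k) n)\<^sup>2)"
    by (rule suminf_finite) (auto simp: ell2_nth_basis)
  then show ?thesis by (simp add: norm_ell2_eq ell2_nth_basis)
qed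

lemma ell2_nth_sum: "ell2_nth (sum f A) n = (\<Sum>k\<in>A. ell2_nth (f k) n)"
  using linear_sum[OF bounded_linear.linear[OF bounded_linear_ell2_nth]] .

lemma ell2_basis_expansion: "(\<lambda>N. \<Sum>k<N. ell2_nth x k *\<^sub>R ell2_basis k) \<longlonglongrightarrow> x"
proof -
  let ?p = "\<lambda>N. \<Sum>k<N. ell2_nth x k *\<^sub>R ell2_basis k"
  have nth: "ell2_nth (x - ?p N) n = (if n < N then 0 else ell2_nth x n)" for N n
    by (simp add: minus_ell2.rep_eq ell2_nth_sum scaleR_ell2.rep_eq ell2_nth_basis if_distrib cong: if_cong)
  have "norm (?p N - x) = sqrt (\<Sum>k. (ell2_nth x (k + N))\<^sup>2)" for N
  proof -
    have "norm (?p N - x) = sqrt (\<Sum>n. (ell2_nth (x - ?p N) n)\<^sup>2)"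
      by (subst norm_minus_commute) (rule norm_ell2_eq)
    also have "(\<Sum>n. (ell2_nth (x - ?p N) n)\<^sup>2) = (\<Sum>n. (ell2_nth (x - ?p N) (n + N))\<^sup>2)"
      using suminf_split_initial_segment[OF summable_ell2_nth, of "x - ?p N" N] by (simp add: nth)
    also have "\<dots> = (\<Sum>k. (ell2_nth x (k + N))\<^sup>2)" by (simp add: nth)
    finally show ?thesis .
  qed
  moreover have "(\<lambda>N. sqrt (\<Sum>k. (ell2_nth x (k + N))\<^sup>2)) \<longlonglongrightarrow> sqrt 0"
    by (intro tendsto_real_sqrt suminf_exist_split2 summable_ell2_nth)
  ultimately show ?thesis
    by (subst LIM_zero_iff[symmetric], subst tendsto_norm_zero_iff[symmetric]) simp
qed

text \<open>
  The finite sections of \<open>x\<close> are combinations of the basis vectors in its support, and they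
  converge to \<open>x\<close>.
\<close>

lemma closed_subspace_contains_supported:
  assumes "subspace J" "closed J" "\<And>k. ell2_nth x k \<noteq> 0 \<Longrightarrow> ell2_basis k \<in> J"
  shows "x \<in> J"
proof (rule closed_sequentially[OF assms(2) _ ell2_basis_expansion])
  have "ell2_nth x k *\<^sub>R ell2_basis k \<in> J" for k
    using assms by (cases "ell2_nth x k = 0") (auto simp: subspace_0 subspace_scale)
  then show "(\<Sum>k<N. ell2_nth x k *\<^sub>R ell2_basis k) \<in> J" for N
    by (intro subspace_sum assms(1))
qed

lemma ell2_basis_in_ideal:
  assumes J: "lattice_ideal J" and x: "x \<in> J" "ell2_nth x k \<noteq> 0"
  shows "ell2_basis k \<in> J"
proof (rule lattice_ideal_hereditary[OF J ell2_basis_nonneg])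
  show "inverse \<bar>ell2_nth x k\<bar> *\<^sub>R \<bar>x\<bar> \<in> J"
    using J x by (simp add: lattice_ideal_abs lattice_ideal_def[THEN iffD1, THEN conjunct1] subspace_scale)
  show "ell2_basis k \<le> inverse \<bar>ell2_nth x k\<bar> *\<^sub>R \<bar>x\<bar>"
    using x(2) by (simp add: less_eq_ell2.rep_eq ell2_nth_basis scaleR_ell2.rep_eq abs_ell2.rep_eq)
qed

lemma initial_ideal_closed_ideal: "lattice_ideal (initial_ideal n)" "closed (initial_ideal n)"
proof -
  show "lattice_ideal (initial_ideal n)"
    unfolding lattice_ideal_def subspace_def
    by (auto simp: initial_ideal_def zero_ell2.rep_eq plus_ell2.rep_eq scaleR_ell2.rep_eq
        less_eq_ell2.rep_eq abs_ell2.rep_eq) (metis abs_eq_0 abs_ge_zero antisym)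
  have "initial_ideal n = (\<Inter>k\<in>{n..}. {x. ell2_nth x k = 0})"
    by (auto simp: initial_ideal_def)
  then show "closed (initial_ideal n)"
    by (auto intro!: closed_INT closed_Collect_eq linear_continuous_on bounded_linear_ell2_nth)
qed

lemma initial_ideal_subsetI:
  assumes "lattice_ideal J" "closed J" "\<And>k. k < n \<Longrightarrow> ell2_basis k \<in> J"
  shows "initial_ideal n \<subseteq> J"
proof
  fix x assume "x \<in> initial_ideal n"
  then have "k < n" if "ell2_nth x k \<noteq> 0" for k
    using that by (force simp: initial_ideal_def not_less[symmetric])
  then show "x \<in> J"
    using assms closed_subspace_contains_supported[of J x] by (auto simp: lattice_ideal_def)
qed

text \<open>
  A closed ideal \<open>J\<close> is determined by the basis vectors that it contains. If \<open>J\<close> lies in no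
  \<open>initial_ideal n\<close>, comparability makes it contain all of them, so \<open>J = UNIV\<close>. Otherwise let \<open>n\<close>
  be least with \<open>J \<subseteq> initial_ideal n\<close>. If \<open>n = m + 1\<close>, then \<open>J\<close> contains \<open>initial_ideal m\<close> and a vector with a nonzero entry at
  \<open>m\<close>, so that \<open>J\<close> also contains the last basis vector of \<open>initial_ideal n\<close>.
\<close>

lemma maxchain_initial_ideals:
  "subset.maxchain {J. lattice_ideal J \<and> closed J} (insert UNIV (range initial_ideal))"
proof (rule maxchain_of_closed_idealsI)
  have "lattice_ideal (UNIV :: ell2 set)" by (simp add: lattice_ideal_def)
  then show "lattice_ideal J \<and> closed J" if "J \<in> insert UNIV (range initial_ideal)" for J
    using that initial_ideal_closed_ideal by auto
  have mono: "initial_ideal m \<subseteq> initial_ideal n" if "m \<le> n" for m n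
    using that by (auto simp: initial_ideal_def)
  show "J \<subseteq> K \<or> K \<subseteq> J"
    if JK: "J \<in> insert UNIV (range initial_ideal)" "K \<in> insert UNIV (range initial_ideal)" for J K
  proof (cases "J = UNIV \<or> K = UNIV")
    case False
    then obtain m n where "J = initial_ideal m" "K = initial_ideal n" using JK by blast
    then show ?thesis using mono[of m n] mono[of n m] linear[of m n] by blast
  qed auto
next
  fix J :: "ell2 set"
  assume J: "lattice_ideal J" "closed J"
    and comparable: "\<And>I. I \<in> insert UNIV (range initial_ideal) \<Longrightarrow> J \<subseteq> I \<or> I \<subseteq> J"
  have comp: "J \<subseteq> initial_ideal n \<or> initial_ideal n \<subseteq> J" for n
    using comparable by blast
  have basis: "ell2_basis k \<in> initial_ideal n" if "k < n" for k n
    using that by (auto simp: initial_ideal_def ell2_nth_basis)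
  show "J \<in> insert UNIV (range initial_ideal)"
  proof (cases "\<exists>n. J \<subseteq> initial_ideal n")
    case False
    then have "ell2_basis k \<in> J" for k using comp[of "Suc k"] basis[of k "Suc k"] by blast
    then have "J = UNIV"
      using J closed_subspace_contains_supported[of J] by (auto simp: lattice_ideal_def)
    then show ?thesis by simp
  next
    case True
    define n where "n = (LEAST n. J \<subseteq> initial_ideal n)"
    have n: "J \<subseteq> initial_ideal n" unfolding n_def by (rule LeastI_ex[OF True])
    have "ell2_basis k \<in> J" if k: "k < n" for k
    proof -
      obtain m where m: "n = Suc m" using k by (cases n) auto
      have "\<not> J \<subseteq> initial_ideal m" using m unfolding n_def by (intro not_less_Least) simp
      then obtain x i where x: "x \<in> J" "m \<le> i" "ell2_nth x i \<noteq> 0"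
        by (auto simp: initial_ideal_def)
      moreover have "i < n" using n x by (force simp: initial_ideal_def not_less[symmetric])
      ultimately have "i = m" using m by simp
      then have "ell2_basis m \<in> J" using ell2_basis_in_ideal[OF J(1) x(1,3)] by simp
      moreover have "initial_ideal m \<subseteq> J" using comp[of m] \<open>\<not> J \<subseteq> initial_ideal m\<close> by blast
      ultimately show ?thesis using basis[of k m] k m by (cases "k = m") auto
    qed
    then have "initial_ideal n \<subseteq> J" by (intro initial_ideal_subsetI J)
    with n show ?thesis by auto
  qed
qed

lemma antimono_weights:
  assumes "donoghue_operator w S" "1 \<le> a" "a \<le> b"
  shows "w b \<le> w a"
  using assms(3)
proof (induction b rule: dec_induct)
  case (step b)
  then show ?case using assms(1,2) unfolding donoghue_operator_def by (meson order_trans)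
qed simp

lemma weights_tendsto_zero:
  assumes "donoghue_operator w S"
  shows "w \<longlonglongrightarrow> 0"
proof -
  have "(\<lambda>n. (w (Suc n))\<^sup>2) \<longlonglongrightarrow> 0"
    using assms by (intro summable_LIMSEQ_zero) (simp add: donoghue_operator_def)
  then have "(\<lambda>n. sqrt ((w (Suc n))\<^sup>2)) \<longlonglongrightarrow> sqrt 0" by (rule tendsto_real_sqrt)
  then have "(\<lambda>n. w (Suc n)) \<longlonglongrightarrow> 0" by (simp add: tendsto_rabs_zero_iff)
  then show ?thesis by (rule LIMSEQ_imp_Suc)
qed

text \<open>
  Both sides are continuous linear functionals of \<open>x\<close>, and they agree on the basis.
\<close>

lemma ell2_nth_donoghue:
  assumes S: "donoghue_operator w S"
  shows "ell2_nth (S x) n = w (Suc n) * ell2_nth x (Suc n)"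
proof -
  have bl: "bounded_linear S" using S by (simp add: donoghue_operator_def)
  then have lin: "linear S" by (rule bounded_linear.linear)
  let ?J = "{x. ell2_nth (S x) n = w (Suc n) * ell2_nth x (Suc n)}"
  have "x \<in> ?J"
  proof (rule closed_subspace_contains_supported)
    show "subspace ?J"
      by (auto simp: subspace_def linear_0[OF lin] linear_add[OF lin] linear_scale[OF lin]
          zero_ell2.rep_eq plus_ell2.rep_eq scaleR_ell2.rep_eq algebra_simps)
    show "closed ?J"
      by (intro closed_Collect_eq continuous_intros linear_continuous_on
          bounded_linear_compose[OF bounded_linear_ell2_nth bl] bounded_linear_ell2_nth)
    show "ell2_basis k \<in> ?J" for k
    proof (cases k)
      case 0
      then show ?thesis using S by (simp add: donoghue_operator_def zero_ell2.rep_eq ell2_nth_basis)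
    next
      case (Suc m)
      then have "S (ell2_basis k) = w k *\<^sub>R ell2_basis m"
        using S by (simp add: donoghue_operator_def)
      with Suc show ?thesis by (simp add: scaleR_ell2.rep_eq ell2_nth_basis)
    qed
  qed
  then show ?thesis by simp
qed

lemma donoghue_weight_pos: "donoghue_operator w S \<Longrightarrow> 0 < w (Suc n)"
  by (simp add: donoghue_operator_def)

lemma positive_op_donoghue:
  assumes "donoghue_operator w S"
  shows "positive_op S"
  unfolding positive_op_def
proof (intro conjI allI impI)
  show "linear S" using assms by (auto simp: donoghue_operator_def bounded_linear.linear)
  show "0 \<le> S x" if "0 \<le> x" for x
    using that by (simp add: less_eq_ell2.rep_eq zero_ell2.rep_eq ell2_nth_donoghue[OF assms]
      less_imp_le[OF donoghue_weight_pos[OF assms]])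
qed

lemma ell2_nth_donoghue_funpow:
  assumes "donoghue_operator w S"
  shows "ell2_nth ((S ^^ m) x) n = (\<Prod>k<m. w (Suc n + k)) * ell2_nth x (n + m)"
proof (induction m arbitrary: n)
  case (Suc m)
  show ?case
    by (simp add: ell2_nth_donoghue[OF assms] Suc.IH prod.lessThan_Suc_shift del: prod.lessThan_Suc)
qed simp

text \<open>
  The matrix of \<open>T\<close> is upper triangular. If \<open>S T \<le> T S\<close>, then \<open>S\<^sup>j\<^sup>+\<^sup>1 T e\<^sub>j \<le> T S\<^sup>j\<^sup>+\<^sup>1 e\<^sub>j = 0\<close>, and the kernel
  of \<open>S\<^sup>j\<^sup>+\<^sup>1\<close> is spanned by \<open>e\<^sub>0, \<dots>, e\<^sub>j\<close>. If \<open>T S \<le> S T\<close>, then comparison of the \<open>i\<close>-th entries of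
  \<open>T S\<^sup>m\<close> and \<open>S\<^sup>m T\<close> at the vector \<open>e\<^sub>j\<^sub>+\<^sub>m\<close> bounds the \<open>(i,j)\<close> entry of \<open>T\<close> by the norm of \<open>T\<close> times the
  ratio of \<open>w\<^sub>i\<^sub>+\<^sub>1 \<cdots> w\<^sub>i\<^sub>+\<^sub>m\<close> to \<open>w\<^sub>j\<^sub>+\<^sub>1 \<cdots> w\<^sub>j\<^sub>+\<^sub>m\<close>. For \<open>i > j\<close>, monotonicity of the weights makes the numerator
  at most \<open>w\<^sub>j\<^sub>+\<^sub>2 \<cdots> w\<^sub>j\<^sub>+\<^sub>m\<^sub>+\<^sub>1\<close>. The ratio then telescopes to \<open>w\<^sub>j\<^sub>+\<^sub>m\<^sub>+\<^sub>1 / w\<^sub>j\<^sub>+\<^sub>1\<close>, which tends to \<open>0\<close>.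
\<close>

lemma op_basis_in_initial_ideal:
  assumes S: "donoghue_operator w S" and T: "positive_op T" and sc: "semi_commute T S"
  shows "T (ell2_basis j) \<in> initial_ideal (Suc j)"
proof -
  let ?W = "\<lambda>n m. \<Prod>k<m. w (Suc n + k)"
  note posS = positive_op_donoghue[OF S]
  have lin: "linear T" using T by (simp add: positive_op_def)
  have W: "0 < ?W n m" for n m
    using donoghue_weight_pos[OF S] by (intro prod_pos) simp
  have nonneg: "0 \<le> ell2_nth (T (ell2_basis k)) i" for k i
    using T ell2_basis_nonneg[of k] by (auto simp: positive_op_def less_eq_ell2.rep_eq zero_ell2.rep_eq)
  have "ell2_nth (T (ell2_basis j)) i \<le> 0" if i: "Suc j \<le> i" for i
    using sc unfolding semi_commute_def
  proof
    assume ge: "op_ge (T \<circ> S) (S \<circ> T)"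
    \<comment> \<open>Reading the inequality at coordinate \<open>d\<close> isolates the entry \<open>i\<close>, up to a positive factor.\<close>
    obtain d where d: "i = d + Suc j" using i by (metis le_Suc_ex add.commute)
    have "(S ^^ Suc j) (ell2_basis j) = 0"
      by (rule ell2_eqI) (simp only: ell2_nth_donoghue_funpow[OF S], simp add: ell2_nth_basis zero_ell2.rep_eq)
    then have "(S ^^ Suc j) (T (ell2_basis j)) \<le> 0"
      using funpow_semi_commute_ge[OF posS ge ell2_basis_nonneg, of "Suc j" j] by (simp only: linear_0[OF lin])
    then have "ell2_nth ((S ^^ Suc j) (T (ell2_basis j))) d \<le> 0"
      by (simp only: less_eq_ell2.rep_eq zero_ell2.rep_eq)
    then have "?W d (Suc j) * ell2_nth (T (ell2_basis j)) i \<le> 0"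
      by (simp only: ell2_nth_donoghue_funpow[OF S] d)
    then show ?thesis using W[of d "Suc j"] by (simp only: mult_le_0_iff) linarith
  next
    assume le: "op_ge (S \<circ> T) (T \<circ> S)"
    define K where "K = onorm T"
    have K: "ell2_nth (T (ell2_basis k)) n \<le> K" for k n
      using abs_ell2_nth_le[of "T (ell2_basis k)" n] onorm[OF positive_op_bounded_linear[OF T], of "ell2_basis k"]
      by (simp add: K_def norm_ell2_basis)
    have "ell2_nth (T (ell2_basis j)) i * w (Suc j) \<le> K * w (Suc j + m)" for m
    proof -
      have "?W j m * ell2_nth (T (ell2_basis j)) i = ell2_nth (T ((S ^^ m) (ell2_basis (j + m)))) i"
      proof -
        have "(S ^^ m) (ell2_basis (j + m)) = ?W j m *\<^sub>R ell2_basis j"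
          by (rule ell2_eqI) (simp add: ell2_nth_donoghue_funpow[OF S] ell2_nth_basis scaleR_ell2.rep_eq)
        then show ?thesis by (simp add: linear_scale[OF lin] scaleR_ell2.rep_eq)
      qed
      also have "\<dots> \<le> ell2_nth ((S ^^ m) (T (ell2_basis (j + m)))) i"
        using funpow_semi_commute_le[OF posS le ell2_basis_nonneg, of m "j + m"]
        by (simp only: less_eq_ell2.rep_eq)
      also have "\<dots> = ?W i m * ell2_nth (T (ell2_basis (j + m))) (i + m)"
        by (rule ell2_nth_donoghue_funpow[OF S])
      also have "\<dots> \<le> ?W (Suc j) m * K"
      proof (intro mult_mono K nonneg prod_mono conjI less_imp_le[OF W])
        show "w (Suc i + k) \<le> w (Suc (Suc j) + k)" "0 \<le> w (Suc i + k)" for k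
          using antimono_weights[OF S, of "Suc (Suc j) + k" "Suc i + k"] i
            less_imp_le[OF donoghue_weight_pos[OF S, of "i + k"]] by simp_all
      qed
      finally have "?W j m * ell2_nth (T (ell2_basis j)) i * w (Suc j) \<le> ?W (Suc j) m * K * w (Suc j)"
        using donoghue_weight_pos[OF S, of j] by simp
      also have "\<dots> = (w (Suc j) * ?W (Suc j) m) * K" by simp
      also have "w (Suc j) * ?W (Suc j) m = ?W j (Suc m)"
        by (simp add: prod.lessThan_Suc_shift del: prod.lessThan_Suc)
      also have "?W j (Suc m) * K = ?W j m * (K * w (Suc j + m))" by simp
      finally have "?W j m * (ell2_nth (T (ell2_basis j)) i * w (Suc j)) \<le> ?W j m * (K * w (Suc j + m))"
        by (simp only: mult.assoc)
      then show ?thesis by (rule mult_left_le_imp_le[OF _ W])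
    qed
    moreover have "(\<lambda>m. K * w (Suc j + m)) \<longlonglongrightarrow> K * 0"
      using LIMSEQ_ignore_initial_segment[OF weights_tendsto_zero[OF S], of "Suc j"]
      by (intro tendsto_mult_left) (simp add: add.commute)
    ultimately have "ell2_nth (T (ell2_basis j)) i * w (Suc j) \<le> K * 0"
      by (intro LIMSEQ_le_const) auto
    then show ?thesis using donoghue_weight_pos[OF S, of j] by (simp add: mult_le_0_iff)
  qed
  with nonneg show ?thesis by (auto simp: initial_ideal_def intro: antisym)
qed

lemma initial_ideal_invariant:
  assumes S: "donoghue_operator w S" and T: "positive_op T" and sc: "semi_commute T S"
  shows "T ` initial_ideal n \<subseteq> initial_ideal n"
proof -
  have "initial_ideal n \<subseteq> {u. T \<bar>u\<bar> \<in> initial_ideal n}"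
  proof (intro initial_ideal_subsetI closed_ideal_pullback[OF T initial_ideal_closed_ideal])
    fix k assume "k < n"
    with op_basis_in_initial_ideal[OF assms, of k]
    have "T (ell2_basis k) \<in> initial_ideal n" by (auto simp: initial_ideal_def)
    then show "ell2_basis k \<in> {u. T \<bar>u\<bar> \<in> initial_ideal n}" by (simp add: ell2_basis_nonneg)
  qed
  then show ?thesis
    using positive_op_in_ideal[OF T initial_ideal_closed_ideal(1)] by blast
qed

lemma donoghue_triangularizable:
  assumes "donoghue_operator w S" "positive_op T" "semi_commute T S"
  shows "ideal_triangularizable {S, T}"
  unfolding ideal_triangularizable_def
  using maxchain_initial_ideals initial_ideal_invariant[OF assms]
    initial_ideal_invariant[OF assms(1) positive_op_donoghue[OF assms(1)] semi_commute_self]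
  by (intro exI[of _ "insert UNIV (range initial_ideal)"]) auto

section \<open>Simultaneous ideal-triangularization\<close>

theorem corollary5p3:
  shows "(\<forall>T :: L2_01 \<Rightarrow> L2_01.
            positive_op T \<and> semi_commute T volterra \<longrightarrow>
            ideal_triangularizable {volterra, T}) \<and>
         (\<forall>(w :: nat \<Rightarrow> real) (S :: ell2 \<Rightarrow> ell2) (T :: ell2 \<Rightarrow> ell2).
            donoghue_operator w S \<and> positive_op T \<and> semi_commute T S \<longrightarrow>
            ideal_triangularizable {S, T})"
  using volterra_triangularizable donoghue_triangularizable by blast

end
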